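(* Let $M\sim CR(X,Y)$ be a compound renewal process, $M(t)=\sum_{k=1}^{N(t)}Y_k$, with waiting times distributed as $X\sim F$. (i) With $\gamma\in\mathbb{R}$ and $H_Y(\gamma)=\mathbb{E}e^{i\gamma Y}$, $$\mathbb{E}\exp\Big(i\gamma\int_0^tM(s)\,ds\Big)=\sum_{n\ge0}\mathbb{E}\Big[\mathop{\ast}_{k=1}^n\Big(e^{i\gamma\sum_{h=k}^nY_h\,\bullet}F(\bullet)\Big)\ast1(t)-\mathop{\ast}_{k=1}^n\Big(e^{i\gamma\sum_{h=k}^nY_h\,\bullet}F(\bullet)\Big)\ast F\ast1(t)\Big]$$ $$=\sum_{n\ge0}\mathbb{E}\Big[\mathbf{1}(X>t-S_n)\prod_{k=1}^nH_Y\big(\gamma(t-S_k)\big)\Big].$$ (ii) If $X$ is absolutely continuous with density $f$ and $\mu>0$, $$\int_0^\infty e^{-\mu t}\,\mathbb{E}\exp\Big(i\gamma\Big(t\sum_{k=1}^{N(t)}Y_k-\int_0^tM(s)\,ds\Big)\Big)dt=\frac{1-\mathcal{L}f(\mu)}{\mu}\sum_{n\ge0}\mathbb{E}\prod_{k=1}^n\mathcal{L}f\Big(\mu+i\gamma\sum_{h=k}^nY_h\Big).$$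
   Context: $M\sim CR(X,Y)$ means $M(t)=\sum_{k=1}^{N(t)}Y_k$, $t\ge0$, where $N$ is a renewal process with i.i.d. waiting times $X_1,X_2,\dots$ distributed as $X$ (with distribution $F$), and $Y_1,Y_2,\dots$ are i.i.d. copies of the real random variable $Y$, independent of $N$. $S_k=X_1+\dots+X_k$ are the arrival times of $N$, $S_0=0$; in the indicator, $X$ is a waiting time independent of $S_1,\dots,S_n$. If the process of partial sums of the $Y_k$ is bounded or nonnegative a.s., $N$ is allowed to explode in finite time intervals; otherwise it is assumed not to explode. For suitable functions $h,g$ and distribution $F$, $hF\ast g(t)=\int_0^tg(t-x)h(x)\,F(dx)$; $\mathop{\ast}_{k=1}^n$ denotes the iterated convolution, $\bullet$ is the placeholder for the argument, and $1$ is the constant function equal to one. $\mathcal{L}f(\mu)=\int_0^\infty e^{-\mu t}f(t)\,dt$ is the Laplace transform. Empty convolutions and products ($n=0$) are the respective identities.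
   Formalization: As printed the formulas fail. In (i) the first series gets the factor e^{iγtΣY_h} inside E and −iγ for iγ in the convolution weights; the indicator also requires S_n≤t; in (ii) Lf(μ−iγΣY_h) replaces Lf(μ+iγΣY_h); X=0 a.s. is excluded. *)

theory Defs
  imports "HOL-Probability.Probability"
begin

text \<open>
  Waiting times \<open>W\<close> and jumps \<open>Z\<close> are indexed from 1; the values at index 0 are never used.
  \<open>X\<close> and \<open>Y\<close> only serve to name the common laws of the \<open>W k\<close> and of the \<open>Z k\<close>.
  For i.i.d. nonnegative waiting times the counting process explodes only if \<open>X = 0\<close> almost
  surely, so \<open>not_null\<close> is exactly non-explosion.
\<close>

locale compound_renewal = prob_space P
  for P :: "'w measure" and X Y :: "'w \<Rightarrow> real" and W Z :: "nat \<Rightarrow> 'w \<Rightarrow> real" +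
  assumes X_measurable: "X \<in> borel_measurable P"
    and Y_measurable: "Y \<in> borel_measurable P"
    and X_nonneg: "AE \<omega> in P. 0 \<le> X \<omega>"
    and not_null: "\<not> (AE \<omega> in P. X \<omega> = 0)"
    and W_law: "\<And>k. 1 \<le> k \<Longrightarrow> distr P borel (W k) = distr P borel X"
    and Z_law: "\<And>k. 1 \<le> k \<Longrightarrow> distr P borel (Z k) = distr P borel Y"
    and indep_W_Z: "indep_vars (\<lambda>_. borel) (case_sum W Z) ({1..} <+> {1..})"

definition arrival :: "(nat \<Rightarrow> 'w \<Rightarrow> real) \<Rightarrow> nat \<Rightarrow> 'w \<Rightarrow> real" where
  "arrival W n \<omega> = (\<Sum>k=1..n. W k \<omega>)"

text \<open>
  On the null set of paths with infinitely many arrivals up to \<open>t\<close>, \<open>card\<close> gives the junk value 0.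
\<close>

definition renewal_count :: "(nat \<Rightarrow> 'w \<Rightarrow> real) \<Rightarrow> real \<Rightarrow> 'w \<Rightarrow> nat" where
  "renewal_count W t \<omega> = card {k. 1 \<le> k \<and> arrival W k \<omega> \<le> t}"

definition CR_process ::
    "(nat \<Rightarrow> 'w \<Rightarrow> real) \<Rightarrow> (nat \<Rightarrow> 'w \<Rightarrow> real) \<Rightarrow> real \<Rightarrow> 'w \<Rightarrow> real" where
  "CR_process W Z t \<omega> = (\<Sum>k=1..renewal_count W t \<omega>. Z k \<omega>)"

definition CR_integral ::
    "(nat \<Rightarrow> 'w \<Rightarrow> real) \<Rightarrow> (nat \<Rightarrow> 'w \<Rightarrow> real) \<Rightarrow> real \<Rightarrow> 'w \<Rightarrow> real" where
  "CR_integral W Z t \<omega> = set_lebesgue_integral lborel {0..t} (\<lambda>s. CR_process W Z s \<omega>)"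

text \<open>
  \<open>wconv h F g\<close> is $hF \ast g$; the domain of integration contains both endpoints, so atoms of
  \<open>F\<close> at 0 and at \<open>t\<close> count.
\<close>

definition wconv ::
    "(real \<Rightarrow> complex) \<Rightarrow> real measure \<Rightarrow> (real \<Rightarrow> complex) \<Rightarrow> real \<Rightarrow> complex" where
  "wconv h F g t = set_lebesgue_integral F {0..t} (\<lambda>x. g (t - x) * h x)"

text \<open>\<open>iter_wconv h F n g\<close> is $h_1F \ast (h_2F \ast (\cdots \ast (h_nF \ast g)))$.\<close>

primrec iter_wconv ::
    "(nat \<Rightarrow> real \<Rightarrow> complex) \<Rightarrow> real measure \<Rightarrow> nat \<Rightarrow> (real \<Rightarrow> complex) \<Rightarrow> real \<Rightarrow> complex" where
  "iter_wconv h F 0 g = g"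
| "iter_wconv h F (Suc n) g = iter_wconv h F n (wconv (h (Suc n)) F g)"

definition laplace :: "(real \<Rightarrow> complex) \<Rightarrow> complex \<Rightarrow> complex" where
  "laplace f \<mu> = set_lebesgue_integral lborel {0..} (\<lambda>t. exp (- \<mu> * of_real t) * f t)"

end

theory Submission
  imports Defs "HOL-Real_Asymp.Real_Asymp"
begin

text \<open>
  On the event $N(t) = n$, i.e. $S_n \le t < S_{n+1}$, the integral $\int_0^t M(s)\,ds$ equals
  $\sum_{k=1}^n Y_k (t - S_k)$, and exchanging the order of summation gives
  $\sum_k Y_k S_k = \sum_k X_k \sum_{h=k}^n Y_h$. All series arise by splitting over $n$; they
  converge absolutely since $P(S_n \le t) \le e^{at} (E e^{-aX})^n$ with $E e^{-aX} < 1$.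
  Integrating out the waiting times first gives the iterated convolutions in (i) and, after a
  further integration over $t$, the products of Laplace transforms in (ii); integrating out
  the jumps first gives the product of characteristic functions.
\<close>

text \<open>Both parts concern expectations of bounded functionals of the pair (waiting times,
  jumps). The two sequences live on one probability space, so such a functional is written with two
  sample points, \<omega> for the waiting times and \<omega>' for the jumps. The diagonal \<omega> =
  \<omega>' is the expectation wanted, and independence allows the two points to be integrated
  separately, in either order. \<open>X\<close> merely names a law and may depend on the
  \<open>W k\<close>, so where a convolution needs one more waiting time, \<open>X\<close> is
  integrated over a sample point of its own. Pathwise identities hold only where all waiting times
  are nonnegative and the arrivals pass t. This event has probability one, so integrals are compared
  almost everywhere. The parameter a of the tail estimate stays free because it has two uses: a = 1
  for fixed t, and a = \<mu>/2 for (ii), where e^(at) has to be beaten by e^(-\<mu>t).\<close>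

text \<open>Fubini for the joint law, which is a product measure by independence. Both laws are
  pulled back to \<open>M\<close>, so that \<omega>' acts as an independent copy of the sample
  point.\<close>

lemma (in prob_space)
  fixes \<phi> :: "_ \<Rightarrow> 'b::{banach, second_countable_topology}"
  assumes ind: "indep_var M1 U M2 V"
    and \<phi>[measurable]: "\<phi> \<in> borel_measurable (M1 \<Otimes>\<^sub>M M2)"
    and bnd: "\<And>x. norm (\<phi> x) \<le> B"
  shows integral_indep_var: "(\<integral>\<omega>. \<phi> (U \<omega>, V \<omega>) \<partial>M) = (\<integral>\<omega>. (\<integral>\<omega>'. \<phi> (U \<omega>, V \<omega>') \<partial>M) \<partial>M)"
    and integral_indep_var': "(\<integral>\<omega>. \<phi> (U \<omega>, V \<omega>) \<partial>M) = (\<integral>\<omega>'. (\<integral>\<omega>. \<phi> (U \<omega>, V \<omega>') \<partial>M) \<partial>M)"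
proof -
  have [measurable]: "U \<in> measurable M M1" "V \<in> measurable M M2"
    using ind by (auto dest: indep_var_rv1 indep_var_rv2)
  interpret U: prob_space "distr M M1 U" by (rule prob_space_distr) measurable
  interpret V: prob_space "distr M M2 V" by (rule prob_space_distr) measurable
  interpret UV: pair_prob_space "distr M M1 U" "distr M M2 V" ..
  have *: "(\<integral>\<omega>. \<phi> (U \<omega>, V \<omega>) \<partial>M) = (\<integral>z. \<phi> z \<partial>(distr M M1 U \<Otimes>\<^sub>M distr M M2 V))"
    using ind by (simp add: indep_var_distribution_eq integral_distr)
  have int: "integrable (distr M M1 U \<Otimes>\<^sub>M distr M M2 V) \<phi>"
    by (rule UV.integrable_const_bound[where B=B]) (use bnd in auto)
  have "(\<integral>z. \<phi> z \<partial>(distr M M1 U \<Otimes>\<^sub>M distr M M2 V)) = (\<integral>x. (\<integral>y. \<phi> (x, y) \<partial>distr M M2 V) \<partial>distr M M1 U)"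
    by (rule UV.integral_fst'[OF int, symmetric])
  also have "\<dots> = (\<integral>x. (\<integral>\<omega>'. \<phi> (x, V \<omega>') \<partial>M) \<partial>distr M M1 U)"
    by (intro Bochner_Integration.integral_cong refl integral_distr) auto
  also have "\<dots> = (\<integral>\<omega>. (\<integral>\<omega>'. \<phi> (U \<omega>, V \<omega>') \<partial>M) \<partial>M)"
    by (rule integral_distr) auto
  finally show "(\<integral>\<omega>. \<phi> (U \<omega>, V \<omega>) \<partial>M) = (\<integral>\<omega>. (\<integral>\<omega>'. \<phi> (U \<omega>, V \<omega>') \<partial>M) \<partial>M)"
    using * by simp
  have "(\<integral>z. \<phi> z \<partial>(distr M M1 U \<Otimes>\<^sub>M distr M M2 V)) = (\<integral>y. (\<integral>x. \<phi> (x, y) \<partial>distr M M1 U) \<partial>distr M M2 V)"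
    using UV.integral_snd[of "\<lambda>x y. \<phi> (x, y)"] int by simp
  also have "\<dots> = (\<integral>y. (\<integral>\<omega>. \<phi> (U \<omega>, y) \<partial>M) \<partial>distr M M2 V)"
    by (intro Bochner_Integration.integral_cong refl integral_distr) auto
  also have "\<dots> = (\<integral>\<omega>'. (\<integral>\<omega>. \<phi> (U \<omega>, V \<omega>') \<partial>M) \<partial>M)"
    by (rule integral_distr) auto
  finally show "(\<integral>\<omega>. \<phi> (U \<omega>, V \<omega>) \<partial>M) = (\<integral>\<omega>'. (\<integral>\<omega>. \<phi> (U \<omega>, V \<omega>') \<partial>M) \<partial>M)"
    using * by simp
qed

text \<open>Injectivity makes the singletons \<open>{f j}\<close> disjoint, so this is independence
  of disjoint blocks, with blocks of size one. It extracts \<open>W\<close> and \<open>Z\<close>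
  from the family indexed by the sum type.\<close>

lemma (in prob_space) indep_vars_reindex:
  assumes "indep_vars M' X I" "inj_on f J" "f ` J \<subseteq> I"
  shows "indep_vars (\<lambda>j. M' (f j)) (\<lambda>j. X (f j)) J"
proof -
  have "indep_vars (\<lambda>j. PiM {f j} M') (\<lambda>j \<omega>. restrict (\<lambda>i. X i \<omega>) {f j}) J"
    by (rule indep_vars_restrict[OF assms(1)])
      (use assms(2,3) in \<open>auto simp: disjoint_family_on_def inj_on_def\<close>)
  then have "indep_vars (\<lambda>j. M' (f j)) (\<lambda>j \<omega>. (\<lambda>x. x (f j)) (restrict (\<lambda>i. X i \<omega>) {f j})) J"
    by (rule indep_vars_compose2) simp
  then show ?thesis
    by simp
qed

lemma iexp_sum: "iexp (\<Sum>k\<in>K. g k) = (\<Prod>k\<in>K. iexp (g k))"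
  by (induction K rule: infinite_finite_induct) (simp_all add: distrib_left exp_add)

text \<open>The half-open interval is the time span on which N(t) = n. Adding the right endpoint
  changes only a null set, after which the fundamental theorem of calculus applies.\<close>

lemma integral_exp_interval:
  fixes a b \<mu> :: real
  assumes "a \<le> b" "0 < \<mu>"
  shows "(\<integral>t. (if a \<le> t \<and> t < b then exp (- \<mu> * t) else 0) \<partial>lborel) = (exp (- \<mu> * a) - exp (- \<mu> * b)) / \<mu>"
proof -
  have "(\<integral>t. (if a \<le> t \<and> t < b then exp (- \<mu> * t) else 0) \<partial>lborel) =
      (\<integral>t. indicator {a..b} t *\<^sub>R exp (- \<mu> * t) \<partial>lborel)"
  proof (rule integral_cong_AE)
    show "AE t in lborel. (if a \<le> t \<and> t < b then exp (- \<mu> * t) else 0) = indicator {a..b} t *\<^sub>R exp (- \<mu> * t)"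
      using AE_lborel_singleton[of b] by eventually_elim (auto simp: indicator_def)
  qed measurable
  also have "\<dots> = (- exp (- \<mu> * b) / \<mu>) - (- exp (- \<mu> * a) / \<mu>)"
    using assms
    by (intro integral_FTC_atLeastAtMost)
      (auto intro!: derivative_eq_intros continuous_intros
        simp flip: has_real_derivative_iff_has_vector_derivative)
  finally show ?thesis
    by (simp add: diff_divide_distrib)
qed

lemma integrable_exp_Ici:
  assumes "0 < (\<mu> :: real)"
  shows "integrable lborel (\<lambda>t. indicator {0..} t * exp (- \<mu> * t))"
proof (rule integrableI_nn_integral_finite)
  have lim: "((\<lambda>t. - exp (- \<mu> * t) / \<mu>) \<longlongrightarrow> 0) at_top"
    using assms by real_asymp
  have "(\<integral>\<^sup>+t. ennreal (exp (- \<mu> * t)) * indicator {0..} t \<partial>lborel) = ennreal (0 - (- exp (- \<mu> * 0) / \<mu>))"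
    using assms by (intro nn_integral_FTC_atLeast[OF _ _ _ lim]) (auto intro!: derivative_eq_intros)
  then show "(\<integral>\<^sup>+t. ennreal (indicator {0..} t * exp (- \<mu> * t)) \<partial>lborel) = ennreal (1 / \<mu>)"
    by (simp add: ennreal_mult' ennreal_indicator mult.commute)
qed auto

section \<open>Pathwise description of the process and of its integral\<close>

lemma arrival_0 [simp]: "arrival W 0 \<omega> = 0"
  and arrival_Suc [simp]: "arrival W (Suc n) \<omega> = arrival W n \<omega> + W (Suc n) \<omega>"
  by (simp_all add: arrival_def)

lemma arrival_mono:
  assumes "\<forall>k\<ge>1. 0 \<le> W k \<omega>" "m \<le> n"
  shows "arrival W m \<omega> \<le> arrival W n \<omega>"
  by (rule lift_Suc_mono_le[OF _ \<open>m \<le> n\<close>]) (use assms(1) in simp)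

text \<open>Summation by parts. It turns a phase in the dependent arrival times into one that is
  additive in the independent waiting times.\<close>

lemma sum_weighted_arrivals:
  fixes z :: "nat \<Rightarrow> real"
  shows "(\<Sum>k=1..n. z k * arrival W k \<omega>) = (\<Sum>k=1..n. W k \<omega> * (\<Sum>h=k..n. z h))"
proof (induction n)
  case (Suc n)
  \<comment> \<open>Raising the upper limit adds \<open>z (Suc n)\<close> to every tail sum with k
    \<le> n and creates one new summand; the additions together make up \<open>z (Suc n)\<close>
    times the arrival time with index \<open>Suc n\<close>.\<close>
  have "(\<Sum>k=1..Suc n. W k \<omega> * (\<Sum>h=k..Suc n. z h)) =
      (\<Sum>k=1..n. W k \<omega> * (\<Sum>h=k..n. z h) + W k \<omega> * z (Suc n)) + W (Suc n) \<omega> * z (Suc n)"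
    by (simp add: distrib_left)
  also have "\<dots> = (\<Sum>k=1..n. W k \<omega> * (\<Sum>h=k..n. z h)) + arrival W (Suc n) \<omega> * z (Suc n)"
    unfolding sum.distrib sum_distrib_right[symmetric] arrival_Suc
    by (simp only: arrival_def distrib_right add.assoc)
  also have "\<dots> = (\<Sum>k=1..Suc n. z k * arrival W k \<omega>)"
    using Suc by (simp del: arrival_Suc)
  finally show ?case
    by (rule sym)
qed simp

text \<open>Waiting times may vanish, so arrival times may coincide. Since t < S_(n+1) is strict,
  monotonicity alone still determines which arrivals have occurred by t.\<close>

lemma between_arrivals:
  assumes nonneg: "\<forall>k\<ge>1. 0 \<le> W k \<omega>"
    and n: "arrival W n \<omega> \<le> t" "t < arrival W (Suc n) \<omega>"
  shows "arrival W k \<omega> \<le> t \<longleftrightarrow> k \<le> n"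
proof (cases "k \<le> n")
  case True
  then show ?thesis
    using arrival_mono[of W \<omega> k n, OF nonneg] n(1) by linarith
next
  case False
  then show ?thesis
    using arrival_mono[of W \<omega> "Suc n" k, OF nonneg] n(2) by linarith
qed

lemma renewal_count_eq:
  assumes "\<forall>k\<ge>1. 0 \<le> W k \<omega>" "arrival W n \<omega> \<le> t" "t < arrival W (Suc n) \<omega>"
  shows "renewal_count W t \<omega> = n"
proof -
  have "{k. 1 \<le> k \<and> arrival W k \<omega> \<le> t} = {1..n}"
    unfolding between_arrivals[OF assms] atLeastAtMost_def atLeast_def atMost_def by (rule Collect_conj_eq)
  then show ?thesis
    by (simp add: renewal_count_def)
qed

lemma CR_process_eq:
  assumes "\<forall>k\<ge>1. 0 \<le> W k \<omega>" "arrival W n \<omega> \<le> t" "t < arrival W (Suc n) \<omega>"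
  shows "CR_process W Z t \<omega> = (\<Sum>k=1..n. Z k \<omega>)"
  using renewal_count_eq[OF assms] by (simp add: CR_process_def)

lemma ex_between_arrivals:
  assumes "0 \<le> t" "t < arrival W m \<omega>"
  obtains n where "arrival W n \<omega> \<le> t" "t < arrival W (Suc n) \<omega>"
proof -
  define m' where "m' = (LEAST m. t < arrival W m \<omega>)"
  have m': "t < arrival W m' \<omega>"
    unfolding m'_def by (rule LeastI) (fact assms)
  then obtain n where n: "m' = Suc n"
    using assms(1) by (cases m') auto
  then have "\<not> t < arrival W n \<omega>"
    using not_less_Least[of n "\<lambda>m. t < arrival W m \<omega>"] by (simp add: m'_def)
  then show thesis
    using that[of n] m' n by simp
qed

text \<open>The k-th jump is part of M(s) exactly for s in [S_k, t], so it contributes its size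
  times t - S_k.\<close>

lemma CR_integral_eq:
  assumes nonneg: "\<forall>k\<ge>1. 0 \<le> W k \<omega>"
    and n: "arrival W n \<omega> \<le> t" "t < arrival W (Suc n) \<omega>"
  shows "CR_integral W Z t \<omega> = (\<Sum>k=1..n. Z k \<omega> * (t - arrival W k \<omega>))"
proof -
  have S: "0 \<le> arrival W k \<omega>" for k
    using arrival_mono[of W \<omega> 0 k] nonneg by simp
  have "CR_process W Z s \<omega> = (\<Sum>k=1..n. Z k \<omega> * indicator {arrival W k \<omega>..t} s)"
    if s: "0 \<le> s" "s \<le> t" for s
  proof -
    obtain m where m: "arrival W m \<omega> \<le> s" "s < arrival W (Suc m) \<omega>"
      using ex_between_arrivals[of s W "Suc n" \<omega>] s n by force
    have iff: "arrival W k \<omega> \<le> s \<longleftrightarrow> k \<le> m" for k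
      by (rule between_arrivals) fact+
    have "m \<le> n"
      using between_arrivals[of W \<omega> n t m, OF nonneg n] m s by auto
    have "CR_process W Z s \<omega> = (\<Sum>k=1..m. Z k \<omega>)"
      by (rule CR_process_eq) fact+
    also have "\<dots> = (\<Sum>k=1..n. if k \<le> m then Z k \<omega> else 0)"
      using \<open>m \<le> n\<close> by (intro sum.mono_neutral_cong_left) auto
    also have "\<dots> = (\<Sum>k=1..n. Z k \<omega> * indicator {arrival W k \<omega>..t} s)"
      unfolding iff[symmetric] using \<open>s \<le> t\<close> by (intro sum.cong) (simp_all add: indicator_def)
    finally show ?thesis .
  qed
  moreover have "indicator {arrival W k \<omega>..t} s = (0::real)" if "\<not> (0 \<le> s \<and> s \<le> t)" for k s
    using that S[of k] by (auto simp: indicator_def)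
  ultimately have "indicator {0..t} s *\<^sub>R CR_process W Z s \<omega> = (\<Sum>k=1..n. Z k \<omega> * indicator {arrival W k \<omega>..t} s)" for s
    by (cases "0 \<le> s \<and> s \<le> t") simp_all
  then have "CR_integral W Z t \<omega> =
      (\<integral>s. (\<Sum>k=1..n. Z k \<omega> * indicator {arrival W k \<omega>..t} s) \<partial>lborel)"
    unfolding CR_integral_def set_lebesgue_integral_def by presburger
  also have "\<dots> = (\<Sum>k=1..n. Z k \<omega> * (\<integral>s. indicator {arrival W k \<omega>..t} s \<partial>lborel))"
    by (subst Bochner_Integration.integral_sum)
      (auto intro!: integrable_real_indicator simp: emeasure_lborel_Icc_eq)
  also have "\<dots> = (\<Sum>k=1..n. Z k \<omega> * (t - arrival W k \<omega>))"
    by (rule sum.cong) (use between_arrivals[of W \<omega> n t, OF nonneg n] in auto)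
  finally show ?thesis .
qed

lemma iter_wconv_cong:
  assumes "\<And>k. k \<in> {1..n} \<Longrightarrow> h k = h' k"
  shows "iter_wconv h F n g = iter_wconv h' F n g"
  using assms by (induction n arbitrary: g) auto

section \<open>Independence, common laws and joint measurability\<close>

context compound_renewal
begin

lemmas X_measurable [measurable] Y_measurable [measurable]

abbreviation seq_space :: "(nat \<Rightarrow> real) measure" where
  "seq_space \<equiv> PiM {1..} (\<lambda>_. borel)"

lemma indep_W: "indep_vars (\<lambda>_. borel) W {1..}"
  using indep_vars_reindex[OF indep_W_Z, of Inl "{1..}"] by auto

lemma indep_Z: "indep_vars (\<lambda>_. borel) Z {1..}"
  using indep_vars_reindex[OF indep_W_Z, of Inr "{1..}"] by auto

lemma W_measurable [measurable (raw)]: "1 \<le> k \<Longrightarrow> W k \<in> borel_measurable P"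
  using indep_W by (auto simp: indep_vars_def)

lemma Z_measurable [measurable (raw)]: "1 \<le> k \<Longrightarrow> Z k \<in> borel_measurable P"
  using indep_Z by (auto simp: indep_vars_def)

lemma arrival_measurable [measurable]: "arrival W n \<in> borel_measurable P"
  unfolding arrival_def[abs_def] by (intro borel_measurable_sum W_measurable) simp

text \<open>The \<open>Inl\<close> and \<open>Inr\<close> blocks of the joint family are disjoint,
  hence independent; \<open>?l\<close> and \<open>?r\<close> only rename their indices to natural
  numbers.\<close>

lemma indep_W_Z_seq:
  "indep_var seq_space (\<lambda>\<omega>. \<lambda>k\<in>{1..}. W k \<omega>) seq_space (\<lambda>\<omega>. \<lambda>k\<in>{1..}. Z k \<omega>)"
proof -
  let ?l = "\<lambda>x. \<lambda>k\<in>{1::nat..}. x (Inl k) :: real" and ?r = "\<lambda>x. \<lambda>k\<in>{1::nat..}. x (Inr k) :: real"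
  have "indep_var seq_space (?l \<circ> (\<lambda>\<omega>. restrict (\<lambda>i. case_sum W Z i \<omega>) (Inl ` {1..})))
      seq_space (?r \<circ> (\<lambda>\<omega>. restrict (\<lambda>i. case_sum W Z i \<omega>) (Inr ` {1..})))"
    by (rule indep_var_compose[OF indep_var_restrict[OF indep_W_Z]])
      (auto intro!: measurable_restrict measurable_component_singleton)
  also have "?l \<circ> (\<lambda>\<omega>. restrict (\<lambda>i. case_sum W Z i \<omega>) (Inl ` {1..})) = (\<lambda>\<omega>. \<lambda>k\<in>{1..}. W k \<omega>)"
    by (auto simp: fun_eq_iff)
  also have "?r \<circ> (\<lambda>\<omega>. restrict (\<lambda>i. case_sum W Z i \<omega>) (Inr ` {1..})) = (\<lambda>\<omega>. \<lambda>k\<in>{1..}. Z k \<omega>)"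
    by (auto simp: fun_eq_iff)
  finally show ?thesis .
qed

text \<open>The hypothesis \<open>eq\<close> exhibits \<psi> as a bounded function of the two whole
  sequences, one evaluated at each sample point, which is what Fubini needs.\<close>

lemma integral_W_Z:
  fixes \<phi> :: "_ \<Rightarrow> complex"
  assumes "\<phi> \<in> borel_measurable (seq_space \<Otimes>\<^sub>M seq_space)" "\<And>x. norm (\<phi> x) \<le> B"
    and eq: "\<And>\<omega> \<omega>'. \<phi> (\<lambda>k\<in>{1..}. W k \<omega>, \<lambda>k\<in>{1..}. Z k \<omega>') = \<psi> \<omega> \<omega>'"
  shows "(\<integral>\<omega>. \<psi> \<omega> \<omega> \<partial>P) = (\<integral>\<omega>. (\<integral>\<omega>'. \<psi> \<omega> \<omega>' \<partial>P) \<partial>P)"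
    and "(\<integral>\<omega>. \<psi> \<omega> \<omega> \<partial>P) = (\<integral>\<omega>'. (\<integral>\<omega>. \<psi> \<omega> \<omega>' \<partial>P) \<partial>P)"
proof -
  show "(\<integral>\<omega>. \<psi> \<omega> \<omega> \<partial>P) = (\<integral>\<omega>. (\<integral>\<omega>'. \<psi> \<omega> \<omega>' \<partial>P) \<partial>P)"
    using integral_indep_var[OF indep_W_Z_seq assms(1,2)] unfolding eq by simp
  show "(\<integral>\<omega>. \<psi> \<omega> \<omega> \<partial>P) = (\<integral>\<omega>'. (\<integral>\<omega>. \<psi> \<omega> \<omega>' \<partial>P) \<partial>P)"
    using integral_indep_var'[OF indep_W_Z_seq assms(1,2)] unfolding eq by simp
qed

lemma integral_W_law:
  fixes g :: "real \<Rightarrow> 'b::{banach, second_countable_topology}"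
  assumes "1 \<le> k" "g \<in> borel_measurable borel"
  shows "(\<integral>\<omega>. g (W k \<omega>) \<partial>P) = (\<integral>\<omega>. g (X \<omega>) \<partial>P)"
  using integral_distr[of "W k" P borel g] integral_distr[of X P borel g] assms
  by (simp add: W_law W_measurable X_measurable)

lemma W_nonneg: "AE \<omega> in P. \<forall>k\<ge>1. 0 \<le> W k \<omega>"
proof -
  have "AE \<omega> in P. 0 \<le> W k \<omega>" if k: "1 \<le> k" for k
  proof -
    have "AE x in distr P borel X. 0 \<le> x"
      using X_nonneg by (subst AE_distr_iff) auto
    then show ?thesis
      using k by (subst (asm) W_law[symmetric, OF k], subst (asm) AE_distr_iff) auto
  qed
  then show ?thesis
    by (auto simp: AE_all_countable)
qed

lemma renewal_count_measurable:
  "(\<lambda>x. renewal_count W (fst x) (snd x)) \<in> measurable (borel \<Otimes>\<^sub>M P) (count_space UNIV)"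
  unfolding renewal_count_def by measurable

text \<open>The count takes countably many values, so it suffices to treat a fixed number of
  summands. Measurability jointly in time and path is what makes the time integral of the process a
  random variable.\<close>

lemma CR_process_measurable_pair:
  "(\<lambda>x. CR_process W Z (fst x) (snd x)) \<in> borel_measurable (borel \<Otimes>\<^sub>M P)"
  unfolding CR_process_def
  by (rule measurable_compose_countable[OF _ renewal_count_measurable])
    (auto intro!: borel_measurable_sum measurable_compose[OF measurable_snd Z_measurable])

lemma CR_process_measurable [measurable (raw)]:
  assumes [measurable]: "f \<in> borel_measurable N" "g \<in> measurable N P"
  shows "(\<lambda>x. CR_process W Z (f x) (g x)) \<in> borel_measurable N"
  using measurable_compose[OF measurable_Pair[OF assms] CR_process_measurable_pair] by simp

lemma CR_integral_measurable [measurable (raw)]: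
  assumes [measurable]: "f \<in> borel_measurable N" "g \<in> measurable N P"
  shows "(\<lambda>x. CR_integral W Z (f x) (g x)) \<in> borel_measurable N"
proof -
  \<comment> \<open>With the variable range of integration written as a condition, the integrand is
    jointly measurable in x and s.\<close>
  have "(\<lambda>x. \<integral>s. (if 0 \<le> s \<and> s \<le> f x then CR_process W Z s (g x) else 0) \<partial>lborel) \<in> borel_measurable N"
    by measurable
  also have "(\<lambda>x. \<integral>s. (if 0 \<le> s \<and> s \<le> f x then CR_process W Z s (g x) else 0) \<partial>lborel) =
      (\<lambda>x. CR_integral W Z (f x) (g x))"
    unfolding CR_integral_def set_lebesgue_integral_def
    by (intro ext Bochner_Integration.integral_cong refl) simp
  finally show ?thesis .
qed

section \<open>Exponential tail bound and non-explosion\<close>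

text \<open>The Laplace transform of the law of \<open>X\<close> at a real argument. As an
  expectation it makes sense without a density, so it is available for both parts.\<close>

definition laplace_X :: "real \<Rightarrow> real" where
  "laplace_X a = (\<integral>\<omega>. exp (- a * X \<omega>) \<partial>P)"

lemma integrable_exp_X: "0 \<le> a \<Longrightarrow> integrable P (\<lambda>\<omega>. exp (- a * X \<omega>))"
  by (rule integrable_const_bound[where B=1]) (use X_nonneg in auto)

lemma laplace_X_nonneg: "0 \<le> laplace_X a"
  unfolding laplace_X_def by (rule Bochner_Integration.integral_nonneg) simp

text \<open>The nonnegative variable 1 - e^(-aX) has expectation zero only if X = 0 almost surely,
  which \<open>not_null\<close> excludes. This strict inequality is the source of all convergence
  below.\<close>

lemma laplace_X_less_1:
  assumes "0 < a"
  shows "laplace_X a < 1"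
proof -
  have int: "integrable P (\<lambda>\<omega>. 1 - exp (- a * X \<omega>))"
    using integrable_exp_X assms by simp
  have nonneg: "AE \<omega> in P. 0 \<le> 1 - exp (- a * X \<omega>)"
    using X_nonneg assms by auto
  have "(\<integral>\<omega>. 1 - exp (- a * X \<omega>) \<partial>P) \<noteq> 0"
    using not_null assms by (subst integral_nonneg_eq_0_iff_AE[OF int nonneg]) auto
  moreover have "0 \<le> (\<integral>\<omega>. 1 - exp (- a * X \<omega>) \<partial>P)"
    by (rule integral_nonneg_AE[OF nonneg])
  moreover have "(\<integral>\<omega>. 1 - exp (- a * X \<omega>) \<partial>P) = 1 - laplace_X a"
    unfolding laplace_X_def using integrable_exp_X[of a] assms by (simp add: prob_space)
  ultimately show ?thesis
    by linarith
qed

lemma summable_laplace_X_power: "0 < a \<Longrightarrow> summable (\<lambda>n. laplace_X a ^ n)"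
  by (rule summable_geometric) (simp add: laplace_X_nonneg laplace_X_less_1)

text \<open>The bound is asked for x \<ge> 0 only, because the exponential weights are unbounded on
  the negative axis; almost sure nonnegativity of the waiting times then yields
  integrability.\<close>

lemma integral_prod_W:
  fixes h :: "nat \<Rightarrow> real \<Rightarrow> 'b::{real_normed_field, banach, second_countable_topology}"
  assumes [measurable]: "\<And>k. h k \<in> borel_measurable borel"
    and bnd: "\<And>k x. 0 \<le> x \<Longrightarrow> norm (h k x) \<le> B"
  shows "(\<integral>\<omega>. (\<Prod>k=1..n. h k (W k \<omega>)) \<partial>P) = (\<Prod>k=1..n. \<integral>\<omega>. h k (X \<omega>) \<partial>P)"
proof -
  have "indep_vars (\<lambda>_. borel) (\<lambda>k \<omega>. h k (W k \<omega>)) {1..n}"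
    by (rule indep_vars_compose2[OF indep_vars_subset[OF indep_W]]) auto
  moreover have "integrable P (\<lambda>\<omega>. h k (W k \<omega>))" if "k \<in> {1..n}" for k
    using that W_nonneg
    by (intro integrable_const_bound[where B=B]) (auto intro!: bnd measurable_compose[OF W_measurable])
  ultimately have "(\<integral>\<omega>. (\<Prod>k=1..n. h k (W k \<omega>)) \<partial>P) = (\<Prod>k=1..n. \<integral>\<omega>. h k (W k \<omega>) \<partial>P)"
    by (intro indep_vars_lebesgue_integral) auto
  also have "\<dots> = (\<Prod>k=1..n. \<integral>\<omega>. h k (X \<omega>) \<partial>P)"
    by (intro prod.cong refl integral_W_law) auto
  finally show ?thesis .
qed

text \<open>Exponential Markov inequality: the indicator of S_n \<le> t is at most e^(at) e^(-a
  S_n), whose expectation factors over the i.i.d. waiting times.\<close>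

lemma prob_arrival_le:
  assumes a: "0 < a"
  shows "\<P>(\<omega> in P. arrival W n \<omega> \<le> t) \<le> exp (a * t) * laplace_X a ^ n"
proof -
  have *: "exp (- a * arrival W n \<omega>) = (\<Prod>k=1..n. exp (- a * W k \<omega>))" for \<omega>
    by (simp add: arrival_def sum_distrib_left flip: exp_sum)
  have int: "integrable P (\<lambda>\<omega>. exp (- a * arrival W n \<omega>))"
  proof (rule integrable_const_bound[where B=1])
    show "AE \<omega> in P. norm (exp (- a * arrival W n \<omega>)) \<le> 1"
      using W_nonneg
    proof eventually_elim
      case (elim \<omega>)
      then show ?case
        using arrival_mono[of W \<omega> 0 n] a by simp
    qed
  qed measurable
  have "\<P>(\<omega> in P. arrival W n \<omega> \<le> t) = (\<integral>\<omega>. indicator {\<omega>\<in>space P. arrival W n \<omega> \<le> t} \<omega> \<partial>P)"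
    by simp
  also have "\<dots> \<le> (\<integral>\<omega>. exp (a * t) * exp (- a * arrival W n \<omega>) \<partial>P)"
    using int a
    by (intro integral_mono integrable_mult_right integrable_real_indicator)
      (auto simp: indicator_def less_top[symmetric] simp flip: exp_add)
  also have "\<dots> = exp (a * t) * (\<Prod>k=1..n. laplace_X a)"
    using integral_prod_W[of "\<lambda>_ x. exp (- a * x)" 1 n] a int
    by (simp add: *[symmetric, simplified] laplace_X_def)
  finally show ?thesis
    by simp
qed

text \<open>The event that all arrivals stay below t lies in each S_n \<le> t, and the probabilities
  of these events decay geometrically.\<close>

lemma arrivals_exceed: "AE \<omega> in P. \<exists>m. t < arrival W m \<omega>"
proof -
  define A where "A = {\<omega>\<in>space P. \<forall>m. arrival W m \<omega> \<le> t}"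
  have [measurable]: "A \<in> sets P"
    unfolding A_def by measurable
  have "prob A \<le> exp (1 * t) * laplace_X 1 ^ n" for n
    by (rule order_trans[OF finite_measure_mono prob_arrival_le]) (auto simp: A_def)
  moreover have "(\<lambda>n. exp (1 * t) * laplace_X 1 ^ n) \<longlonglongrightarrow> 0"
    using laplace_X_nonneg laplace_X_less_1[of 1]
    by (intro tendsto_mult_right_zero LIMSEQ_power_zero) simp
  ultimately have "prob A \<le> 0"
    by (meson LIMSEQ_le_const)
  then have "prob A = 0"
    using measure_le_0_iff by blast
  then have "AE \<omega> in P. \<omega> \<notin> A"
    by (simp add: prob_eq_0)
  then show ?thesis
    by (rule AE_mp) (auto simp: A_def not_le)
qed

section \<open>Splitting expectations according to the number of arrivals\<close>

text \<open>The event N(t) = n on paths with nonnegative waiting times. It involves two arrival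
  times only, unlike \<open>renewal_count\<close>, which looks at all of them.\<close>

abbreviation epoch :: "nat \<Rightarrow> real \<Rightarrow> 'w \<Rightarrow> bool" where
  "epoch n t \<omega> \<equiv> arrival W n \<omega> \<le> t \<and> t < arrival W (Suc n) \<omega>"

text \<open>Almost surely exactly one summand is nonzero before integration, and the tail bound with
  a = 1 makes the L1 norms summable, so sum and expectation may be exchanged. \<Phi> takes both M(t)
  and its integral: (i) uses the second argument, (ii) uses both.\<close>

lemma sums_epochs:
  fixes \<Phi> :: "real \<Rightarrow> real \<Rightarrow> complex"
  assumes t: "0 \<le> t"
    and [measurable]: "case_prod \<Phi> \<in> borel_measurable (borel \<Otimes>\<^sub>M borel)"
    and bnd: "\<And>x y. norm (\<Phi> x y) \<le> 1"
  shows "(\<lambda>n. \<integral>\<omega>. of_bool (epoch n t \<omega>) *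
        \<Phi> (\<Sum>k=1..n. Z k \<omega>) (\<Sum>k=1..n. Z k \<omega> * (t - arrival W k \<omega>)) \<partial>P)
      sums (\<integral>\<omega>. \<Phi> (CR_process W Z t \<omega>) (CR_integral W Z t \<omega>) \<partial>P)"
proof -
  define f where "f n \<omega> = of_bool (epoch n t \<omega>) *
        \<Phi> (\<Sum>k=1..n. Z k \<omega>) (\<Sum>k=1..n. Z k \<omega> * (t - arrival W k \<omega>))" for n \<omega>
  have [measurable]: "(\<lambda>\<omega>. \<Sum>k=1..n. Z k \<omega>) \<in> borel_measurable P"
    "(\<lambda>\<omega>. \<Sum>k=1..n. Z k \<omega> * (t - arrival W k \<omega>)) \<in> borel_measurable P" for n
    by (auto intro!: borel_measurable_sum borel_measurable_times Z_measurable)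
  have \<Phi>_meas [measurable (raw)]: "(\<lambda>\<omega>. \<Phi> (u \<omega>) (v \<omega>)) \<in> borel_measurable P"
    if "u \<in> borel_measurable P" "v \<in> borel_measurable P" for u v
    using measurable_compose[OF measurable_Pair[OF that], of "case_prod \<Phi>"] by simp
  have f_meas [measurable]: "f n \<in> borel_measurable P" for n
    unfolding f_def of_bool_def by measurable
  have f_le: "norm (f n \<omega>) \<le> of_bool (arrival W n \<omega> \<le> t)" for n \<omega>
    unfolding f_def norm_mult by (rule order_trans[OF mult_mono[OF order_refl bnd]]) auto
  have int: "integrable P (f n)" for n
    by (rule integrable_const_bound[where B=1])
      (auto intro!: order_trans[OF f_le])
  have single: "AE \<omega> in P. \<exists>n. \<forall>k. f k \<omega> =
      (if k = n then \<Phi> (CR_process W Z t \<omega>) (CR_integral W Z t \<omega>) else 0)"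
    using W_nonneg arrivals_exceed[of t]
  proof eventually_elim
    case (elim \<omega>)
    then obtain n where n: "arrival W n \<omega> \<le> t" "t < arrival W (Suc n) \<omega>"
      using ex_between_arrivals[OF t] by metis
    \<comment> \<open>If the indicator for k is nonzero, then k \<le> n but not \<open>Suc k\<close>
      \<le> n, which leaves k = n.\<close>
    have "f k \<omega> = (if k = n then \<Phi> (CR_process W Z t \<omega>) (CR_integral W Z t \<omega>) else 0)" for k
      unfolding f_def CR_process_eq[OF elim(1) n] CR_integral_eq[OF elim(1) n]
      using between_arrivals[OF elim(1) n, of k] between_arrivals[OF elim(1) n, of "Suc k"] n
      by (auto simp del: arrival_Suc)
    then show ?case
      by blast
  qed
  have "(\<lambda>n. integral\<^sup>L P (f n)) sums (\<integral>\<omega>. (\<Sum>n. f n \<omega>) \<partial>P)"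
  proof (rule sums_integral[OF int])
    show "AE \<omega> in P. summable (\<lambda>n. norm (f n \<omega>))"
      using single
    proof eventually_elim
      case (elim \<omega>)
      then obtain n where n: "\<And>k. f k \<omega> =
          (if k = n then \<Phi> (CR_process W Z t \<omega>) (CR_integral W Z t \<omega>) else 0)"
        by blast
      show ?case
        by (rule summable_finite[of "{n}"]) (auto simp: n)
    qed
    show "summable (\<lambda>n. \<integral>\<omega>. norm (f n \<omega>) \<partial>P)"
    proof (rule summable_comparison_test'[OF summable_mult[OF summable_laplace_X_power]])
      fix n
      have "(\<integral>\<omega>. norm (f n \<omega>) \<partial>P) \<le> (\<integral>\<omega>. indicator {\<omega>\<in>space P. arrival W n \<omega> \<le> t} \<omega> \<partial>P)"
        using int f_le
        by (intro integral_mono integrable_norm integrable_real_indicator)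
          (auto simp: indicator_def less_top[symmetric])
      also have "\<dots> \<le> exp (1 * t) * laplace_X 1 ^ n"
        using prob_arrival_le[of 1 n t] by simp
      finally show "norm (\<integral>\<omega>. norm (f n \<omega>) \<partial>P) \<le> exp (1 * t) * laplace_X 1 ^ n"
        by simp
    qed simp
  qed
  also have "(\<integral>\<omega>. (\<Sum>n. f n \<omega>) \<partial>P) = (\<integral>\<omega>. \<Phi> (CR_process W Z t \<omega>) (CR_integral W Z t \<omega>) \<partial>P)"
  proof (rule integral_cong_AE)
    show "AE \<omega> in P. (\<Sum>n. f n \<omega>) = \<Phi> (CR_process W Z t \<omega>) (CR_integral W Z t \<omega>)"
      using single
    proof eventually_elim
      case (elim \<omega>)
      then obtain n where n: "\<And>k. f k \<omega> =
          (if k = n then \<Phi> (CR_process W Z t \<omega>) (CR_integral W Z t \<omega>) else 0)"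
        by blast
      show ?case
        by (subst suminf_finite[of "{n}"]) (auto simp: n)
    qed
  qed measurable
  finally show ?thesis
    unfolding f_def .
qed

section \<open>Iterated convolutions as expectations over waiting times\<close>

abbreviation F where "F \<equiv> distr P borel X"

lemma wconv_eq:
  assumes [measurable]: "h \<in> borel_measurable borel" "g \<in> borel_measurable borel"
  shows "wconv h F g s = (\<integral>\<omega>. (if 0 \<le> X \<omega> \<and> X \<omega> \<le> s then g (s - X \<omega>) * h (X \<omega>) else 0) \<partial>P)"
proof -
  have "wconv h F g s = (\<integral>x. (if 0 \<le> x \<and> x \<le> s then g (s - x) * h x else 0) \<partial>F)"
    unfolding wconv_def set_lebesgue_integral_def by (intro Bochner_Integration.integral_cong) auto
  then show ?thesis
    by (simp add: integral_distr)
qed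

lemma wconv_measurable [measurable]:
  assumes [measurable]: "h \<in> borel_measurable borel" "g \<in> borel_measurable borel"
  shows "wconv h F g \<in> borel_measurable borel"
  unfolding wconv_eq[OF assms, abs_def] by measurable

lemma norm_wconv_le_1:
  assumes [measurable]: "h \<in> borel_measurable borel" "g \<in> borel_measurable borel"
    and bnd: "\<And>x. norm (h x) \<le> 1" "\<And>x. norm (g x) \<le> 1"
  shows "norm (wconv h F g s) \<le> 1"
proof -
  let ?f = "\<lambda>\<omega>. if 0 \<le> X \<omega> \<and> X \<omega> \<le> s then g (s - X \<omega>) * h (X \<omega>) else 0"
  have le: "norm (?f \<omega>) \<le> 1" for \<omega>
    using bnd by (auto simp: norm_mult intro!: mult_le_one)
  have "integrable P ?f"
    by (rule integrable_const_bound[where B=1]) (use le in auto)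
  then have "(\<integral>\<omega>. norm (?f \<omega>) \<partial>P) \<le> 1"
    by (intro integral_le_const integrable_norm AE_I2 le)
  then have "norm (integral\<^sup>L P ?f) \<le> 1"
    by (rule order_trans[OF integral_norm_bound])
  then show ?thesis
    by (simp add: wconv_eq)
qed

text \<open>\<open>W (Suc n)\<close> is independent of the first n waiting times and distributed
  like \<open>X\<close>. As \<open>X\<close> has its own variable of integration, only its law
  enters.\<close>

lemma integral_W_Suc:
  fixes \<phi> :: "(nat \<Rightarrow> real) \<times> real \<Rightarrow> complex"
  assumes \<phi>: "\<phi> \<in> borel_measurable (PiM {1..n} (\<lambda>_. borel) \<Otimes>\<^sub>M borel)"
    and bnd: "\<And>x. norm (\<phi> x) \<le> B"
  shows "(\<integral>\<omega>. \<phi> (\<lambda>k\<in>{1..n}. W k \<omega>, W (Suc n) \<omega>) \<partial>P) =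
    (\<integral>\<omega>. (\<integral>\<omega>'. \<phi> (\<lambda>k\<in>{1..n}. W k \<omega>, X \<omega>') \<partial>P) \<partial>P)"
proof -
  have ind: "indep_var (PiM {1..n} (\<lambda>_. borel)) (\<lambda>\<omega>. \<lambda>k\<in>{1..n}. W k \<omega>)
      (PiM {Suc n} (\<lambda>_. borel)) (\<lambda>\<omega>. \<lambda>k\<in>{Suc n}. W k \<omega>)"
    by (rule indep_var_restrict[OF indep_W]) auto
  have meas: "(\<lambda>(w, v). \<phi> (w, v (Suc n))) \<in>
      borel_measurable (PiM {1..n} (\<lambda>_. borel) \<Otimes>\<^sub>M PiM {Suc n} (\<lambda>_. borel))"
    using \<phi> by measurable
  have "(\<integral>\<omega>. \<phi> (\<lambda>k\<in>{1..n}. W k \<omega>, W (Suc n) \<omega>) \<partial>P) =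
      (\<integral>\<omega>. (\<integral>\<omega>'. \<phi> (\<lambda>k\<in>{1..n}. W k \<omega>, W (Suc n) \<omega>') \<partial>P) \<partial>P)"
    using integral_indep_var[OF ind meas, of B] bnd by (simp add: split_beta)
  also have "\<dots> = (\<integral>\<omega>. (\<integral>\<omega>'. \<phi> (\<lambda>k\<in>{1..n}. W k \<omega>, X \<omega>') \<partial>P) \<partial>P)"
    by (rule Bochner_Integration.integral_cong[OF refl], rule integral_W_law)
      (auto intro!: measurable_compose[OF _ \<phi>] measurable_Pair1' simp: space_PiM extensional_def)
  finally show ?thesis .
qed

text \<open>Each convolution integrates out one waiting time and leaves g at the remaining time. The
  recursion absorbs the last weight into g, so the induction must let g vary.\<close>

lemma iter_wconv_eq:
  assumes h [measurable]: "\<And>k. h k \<in> borel_measurable borel" and g: "g \<in> borel_measurable borel"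
    and h_le: "\<And>k x. norm (h k x) \<le> 1" and g_le: "\<And>x. norm (g x) \<le> 1"
    and t: "0 \<le> t"
  shows "iter_wconv h F n g t =
    (\<integral>\<omega>. of_bool (arrival W n \<omega> \<le> t) * (\<Prod>k=1..n. h k (W k \<omega>)) * g (t - arrival W n \<omega>) \<partial>P)"
  using g g_le
proof (induction n arbitrary: g)
  case 0
  then show ?case
    using t by (simp add: prob_space)
next
  case (Suc n)
  note [measurable] = Suc.prems(1)
  define A :: "(nat \<Rightarrow> real) \<Rightarrow> real" where "A w = (\<Sum>k=1..n. w k)" for w
  have [measurable]: "A \<in> borel_measurable (PiM {1..n} (\<lambda>_. borel))"
    unfolding A_def[abs_def] by (intro borel_measurable_sum measurable_component_singleton)
  have A: "A (\<lambda>k\<in>{1..n}. W k \<omega>) = arrival W n \<omega>" for \<omega>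
    unfolding A_def arrival_def by (rule sum.cong) auto
  define H :: "(nat \<Rightarrow> real) \<Rightarrow> complex" where "H w = (\<Prod>k=1..n. h k (w k))" for w
  have [measurable]: "H \<in> borel_measurable (PiM {1..n} (\<lambda>_. borel))"
    unfolding H_def[abs_def]
    by (intro borel_measurable_prod measurable_compose[OF _ h] measurable_component_singleton)
  have H: "H (\<lambda>k\<in>{1..n}. W k \<omega>) = (\<Prod>k=1..n. h k (W k \<omega>))" for \<omega>
    unfolding H_def by (rule prod.cong) auto
  have H_le: "norm (H w) \<le> 1" for w
    unfolding H_def prod_norm[symmetric] by (rule prod_le_1) (use h_le in auto)
  \<comment> \<open>The conditions on x reproduce the closed domain of integration of
    \<open>wconv\<close>, shifted by the time already used up.\<close>
  define \<phi> where "\<phi> = (\<lambda>(w, x). if A w \<le> t \<and> 0 \<le> x \<and> x \<le> t - A w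
      then H w * (g (t - A w - x) * h (Suc n) x) else 0)"
  have \<phi>_meas: "\<phi> \<in> borel_measurable (PiM {1..n} (\<lambda>_. borel) \<Otimes>\<^sub>M borel)"
    unfolding \<phi>_def by measurable
  have \<phi>_le: "norm (\<phi> x) \<le> 1" for x
    using H_le h_le Suc.prems(2)
    by (auto simp: \<phi>_def norm_mult split: prod.split intro!: mult_le_one)
  have "iter_wconv h F (Suc n) g t =
      (\<integral>\<omega>. of_bool (arrival W n \<omega> \<le> t) * (\<Prod>k=1..n. h k (W k \<omega>)) *
        wconv (h (Suc n)) F g (t - arrival W n \<omega>) \<partial>P)"
    unfolding iter_wconv.simps by (rule Suc.IH) (use norm_wconv_le_1 h_le Suc.prems in auto)
  also have "\<dots> = (\<integral>\<omega>. (\<integral>\<omega>'. \<phi> (\<lambda>k\<in>{1..n}. W k \<omega>, X \<omega>') \<partial>P) \<partial>P)"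
  proof (intro Bochner_Integration.integral_cong refl)
    fix \<omega>
    show "of_bool (arrival W n \<omega> \<le> t) * (\<Prod>k=1..n. h k (W k \<omega>)) *
        wconv (h (Suc n)) F g (t - arrival W n \<omega>) =
        (\<integral>\<omega>'. \<phi> (\<lambda>k\<in>{1..n}. W k \<omega>, X \<omega>') \<partial>P)"
      unfolding wconv_eq[OF h Suc.prems(1)] \<phi>_def prod.case A H integral_mult_right_zero[symmetric]
      by (intro Bochner_Integration.integral_cong refl) auto
  qed
  also have "\<dots> = (\<integral>\<omega>. \<phi> (\<lambda>k\<in>{1..n}. W k \<omega>, W (Suc n) \<omega>) \<partial>P)"
    by (rule integral_W_Suc[OF \<phi>_meas \<phi>_le, symmetric])
  also have "\<dots> = (\<integral>\<omega>. of_bool (arrival W (Suc n) \<omega> \<le> t) * (\<Prod>k=1..Suc n. h k (W k \<omega>)) *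
      g (t - arrival W (Suc n) \<omega>) \<partial>P)"
  proof (rule integral_cong_AE)
    show "AE \<omega> in P. \<phi> (\<lambda>k\<in>{1..n}. W k \<omega>, W (Suc n) \<omega>) =
      of_bool (arrival W (Suc n) \<omega> \<le> t) * (\<Prod>k=1..Suc n. h k (W k \<omega>)) *
        g (t - arrival W (Suc n) \<omega>)"
      using W_nonneg
    proof eventually_elim
      case (elim \<omega>)
      then have "0 \<le> W (Suc n) \<omega>"
        by simp
      \<comment> \<open>For a nonnegative last waiting time the three conditions in \<phi> collapse
        to S_(n+1) \<le> t.\<close>
      then show ?case
        unfolding \<phi>_def prod.case A H by (auto simp: algebra_simps)
    qed
    show "(\<lambda>\<omega>. \<phi> (\<lambda>k\<in>{1..n}. W k \<omega>, W (Suc n) \<omega>)) \<in> borel_measurable P"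
      by (rule measurable_compose[OF _ \<phi>_meas])
        (auto intro!: measurable_Pair measurable_restrict W_measurable)
    show "(\<lambda>\<omega>. of_bool (arrival W (Suc n) \<omega> \<le> t) * (\<Prod>k=1..Suc n. h k (W k \<omega>)) *
        g (t - arrival W (Suc n) \<omega>)) \<in> borel_measurable P"
      unfolding of_bool_def
      by (intro borel_measurable_times borel_measurable_prod measurable_compose[OF W_measurable h])
        (auto simp del: arrival_Suc)
  qed
  finally show ?case .
qed

text \<open>The two terms carry the indicators of S_n \<le> t and S_(n+1) \<le> t. Arrival times are
  nondecreasing, so the difference of these is the indicator of N(t) = n.\<close>

lemma iter_wconv_epoch:
  assumes h [measurable]: "\<And>k. h k \<in> borel_measurable borel"
    and h_le: "\<And>k x. norm (h k x) \<le> 1"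
    and t: "0 \<le> t"
  shows "iter_wconv h F n (\<lambda>_. 1) t - iter_wconv h F n (wconv (\<lambda>_. 1) F (\<lambda>_. 1)) t =
    (\<integral>\<omega>. of_bool (epoch n t \<omega>) * (\<Prod>k=1..n. h k (W k \<omega>)) \<partial>P)"
proof -
  define H where "H \<omega> = (\<Prod>k=1..n. h k (W k \<omega>))" for \<omega>
  have [measurable]: "H \<in> borel_measurable P"
    unfolding H_def[abs_def] by (intro borel_measurable_prod measurable_compose[OF W_measurable h]) simp
  have H_le: "norm (H \<omega>) \<le> 1" for \<omega>
    unfolding H_def prod_norm[symmetric] by (rule prod_le_1) (use h_le in auto)
  have int: "integrable P (\<lambda>\<omega>. of_bool (arrival W m \<omega> \<le> t) * H \<omega>)" for m
  proof (rule integrable_const_bound[where B=1])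
    show "(\<lambda>\<omega>. of_bool (arrival W m \<omega> \<le> t) * H \<omega>) \<in> borel_measurable P"
      unfolding of_bool_def by measurable
  qed (use H_le in \<open>auto simp: norm_mult\<close>)
  \<comment> \<open>the extra convolution with \<open>F\<close> is an iterated convolution of length \<open>n + 1\<close> with trivial last weight\<close>
  define h' where "h' = h(Suc n := \<lambda>_. 1)"
  have "iter_wconv h F n (wconv (\<lambda>_. 1) F (\<lambda>_. 1)) t = iter_wconv h' F (Suc n) (\<lambda>_. 1) t"
    using iter_wconv_cong[of n h h'] by (simp add: h'_def)
  also have "\<dots> = (\<integral>\<omega>. of_bool (arrival W (Suc n) \<omega> \<le> t) * (\<Prod>k=1..Suc n. h' k (W k \<omega>)) * 1 \<partial>P)"
    by (rule iter_wconv_eq) (use h_le t in \<open>auto simp: h'_def\<close>)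
  also have "\<dots> = (\<integral>\<omega>. of_bool (arrival W (Suc n) \<omega> \<le> t) * H \<omega> \<partial>P)"
    by (intro Bochner_Integration.integral_cong refl)
      (auto simp: h'_def H_def simp del: arrival_Suc intro!: prod.cong)
  finally have "iter_wconv h F n (\<lambda>_. 1) t - iter_wconv h F n (wconv (\<lambda>_. 1) F (\<lambda>_. 1)) t =
      (\<integral>\<omega>. of_bool (arrival W n \<omega> \<le> t) * H \<omega> \<partial>P) - (\<integral>\<omega>. of_bool (arrival W (Suc n) \<omega> \<le> t) * H \<omega> \<partial>P)"
    using iter_wconv_eq[of h "\<lambda>_. 1" t n] h_le t by (simp add: H_def)
  also have "\<dots> = (\<integral>\<omega>. of_bool (arrival W n \<omega> \<le> t) * H \<omega> - of_bool (arrival W (Suc n) \<omega> \<le> t) * H \<omega> \<partial>P)"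
    by (rule Bochner_Integration.integral_diff[OF int int, symmetric])
  also have "\<dots> = (\<integral>\<omega>. of_bool (epoch n t \<omega>) * H \<omega> \<partial>P)"
  proof (rule integral_cong_AE)
    show "AE \<omega> in P. of_bool (arrival W n \<omega> \<le> t) * H \<omega> - of_bool (arrival W (Suc n) \<omega> \<le> t) * H \<omega> =
        of_bool (epoch n t \<omega>) * H \<omega>"
      using W_nonneg
    proof eventually_elim
      case (elim \<omega>)
      then have "arrival W n \<omega> \<le> arrival W (Suc n) \<omega>"
        by (intro arrival_mono) auto
      then show ?case
        by (auto simp del: arrival_Suc)
    qed
    show "(\<lambda>\<omega>. of_bool (arrival W n \<omega> \<le> t) * H \<omega> - of_bool (arrival W (Suc n) \<omega> \<le> t) * H \<omega>) \<in> borel_measurable P"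
      by (rule borel_measurable_diff) (use int in auto)
    show "(\<lambda>\<omega>. of_bool (epoch n t \<omega>) * H \<omega>) \<in> borel_measurable P"
      unfolding of_bool_def by measurable
  qed
  finally show ?thesis
    unfolding H_def .
qed

section \<open>Separating waiting times from jumps, and the two series of (i)\<close>

text \<open>One interchange for both parts. With (c, d) = (\<gamma>t, -\<gamma>) and b the indicator
  of N(t) = n it serves (i); with (0, \<gamma>) and b the time integral of the discounted indicator,
  up to the factor 1/\<mu>, it serves (ii).\<close>

lemma
  fixes b :: "real \<Rightarrow> real \<Rightarrow> complex"
  assumes b: "case_prod b \<in> borel_measurable (borel \<Otimes>\<^sub>M borel)"
    and b_le: "\<And>x y. norm (b x y) \<le> 1"
  defines "\<psi> \<equiv> \<lambda>n c d \<omega> \<omega>'. b (arrival W n \<omega>) (arrival W (Suc n) \<omega>) *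
      iexp (\<Sum>k=1..n. Z k \<omega>' * (c + d * arrival W k \<omega>))"
  shows integral_arrivals_jumps:
      "(\<integral>\<omega>. \<psi> n c d \<omega> \<omega> \<partial>P) = (\<integral>\<omega>. (\<integral>\<omega>'. \<psi> n c d \<omega> \<omega>' \<partial>P) \<partial>P)"
    and integral_arrivals_jumps':
      "(\<integral>\<omega>. \<psi> n c d \<omega> \<omega> \<partial>P) = (\<integral>\<omega>'. (\<integral>\<omega>. \<psi> n c d \<omega> \<omega>' \<partial>P) \<partial>P)"
proof -
  define A :: "nat \<Rightarrow> (nat \<Rightarrow> real) \<Rightarrow> real" where "A m w = (\<Sum>k=1..m. w k)" for m w
  have [measurable]: "A m \<in> borel_measurable seq_space" for m
    unfolding A_def[abs_def] by (intro borel_measurable_sum measurable_component_singleton) simp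
  have A: "A m (\<lambda>k\<in>{1..}. W k \<omega>) = arrival W m \<omega>" for m \<omega>
    unfolding A_def arrival_def by (rule sum.cong) auto
  define \<phi> where "\<phi> = (\<lambda>(w, z). b (A n w) (A (Suc n) w) * iexp (\<Sum>k=1..n. z k * (c + d * A k w)))"
  have m: "(\<lambda>x. A m (fst x)) \<in> borel_measurable (seq_space \<Otimes>\<^sub>M seq_space)" for m
    by measurable
  have "(\<lambda>x. b (A n (fst x)) (A (Suc n) (fst x))) \<in> borel_measurable (seq_space \<Otimes>\<^sub>M seq_space)"
    using measurable_compose[OF measurable_Pair[OF m[of n] m[of "Suc n"]] b] by simp
  moreover have "(\<lambda>x. \<Sum>k=1..n. snd x k * (c + d * A k (fst x))) \<in> borel_measurable (seq_space \<Otimes>\<^sub>M seq_space)"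
    by (intro borel_measurable_sum borel_measurable_times borel_measurable_add borel_measurable_const m) auto
  ultimately have meas: "\<phi> \<in> borel_measurable (seq_space \<Otimes>\<^sub>M seq_space)"
    unfolding \<phi>_def split_beta by measurable
  have le: "norm (\<phi> x) \<le> 1" for x
    using b_le by (auto simp: \<phi>_def norm_mult split: prod.split)
  have eq: "\<phi> (\<lambda>k\<in>{1..}. W k \<omega>, \<lambda>k\<in>{1..}. Z k \<omega>') = \<psi> n c d \<omega> \<omega>'" for \<omega> \<omega>'
    unfolding \<phi>_def \<psi>_def prod.case A by simp
  show "(\<integral>\<omega>. \<psi> n c d \<omega> \<omega> \<partial>P) = (\<integral>\<omega>. (\<integral>\<omega>'. \<psi> n c d \<omega> \<omega>' \<partial>P) \<partial>P)"
    "(\<integral>\<omega>. \<psi> n c d \<omega> \<omega> \<partial>P) = (\<integral>\<omega>'. (\<integral>\<omega>. \<psi> n c d \<omega> \<omega>' \<partial>P) \<partial>P)"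
    by (rule integral_W_Z[OF meas le eq])+
qed

text \<open>For fixed jumps the phase splits into \<gamma>t times the sum of all jumps, constant in
  the waiting times and hence the factor in front, and a part additive in the waiting times, whose
  exponential is the product of weights.\<close>

lemma integral_epoch_Z:
  assumes t: "0 \<le> t"
  shows "(\<integral>\<omega>. of_bool (epoch n t \<omega>) * iexp (\<gamma> * (\<Sum>k=1..n. Z k \<omega> * (t - arrival W k \<omega>))) \<partial>P) =
    (\<integral>\<omega>. iexp (\<gamma> * t * (\<Sum>h=1..n. Z h \<omega>)) *
       (iter_wconv (\<lambda>k x. iexp (- \<gamma> * (\<Sum>h=k..n. Z h \<omega>) * x)) F n (\<lambda>_. 1) t
      - iter_wconv (\<lambda>k x. iexp (- \<gamma> * (\<Sum>h=k..n. Z h \<omega>) * x)) F n (wconv (\<lambda>_. 1) F (\<lambda>_. 1)) t) \<partial>P)"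
proof -
  define b :: "real \<Rightarrow> real \<Rightarrow> complex" where "b x y = of_bool (x \<le> t \<and> t < y)" for x y
  have b: "case_prod b \<in> borel_measurable (borel \<Otimes>\<^sub>M borel)" "\<And>x y. norm (b x y) \<le> 1"
    unfolding b_def of_bool_def split_beta by auto
  have eq: "\<gamma> * (\<Sum>k=1..n. Z k \<omega>' * (t - arrival W k \<omega>)) =
      (\<Sum>k=1..n. Z k \<omega>' * (\<gamma> * t + (- \<gamma>) * arrival W k \<omega>))" for \<omega> \<omega>'
    by (simp add: sum_distrib_left algebra_simps)
  have split: "iexp (\<gamma> * (\<Sum>k=1..n. Z k \<omega>' * (t - arrival W k \<omega>))) =
      iexp (\<gamma> * t * (\<Sum>h=1..n. Z h \<omega>')) * (\<Prod>k=1..n. iexp (- \<gamma> * (\<Sum>h=k..n. Z h \<omega>') * W k \<omega>))" for \<omega> \<omega>'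
  proof -
    have "\<gamma> * (\<Sum>k=1..n. Z k \<omega>' * (t - arrival W k \<omega>)) =
        \<gamma> * t * (\<Sum>h=1..n. Z h \<omega>') - \<gamma> * (\<Sum>k=1..n. Z k \<omega>' * arrival W k \<omega>)"
      by (simp add: right_diff_distrib sum_subtractf sum_distrib_left mult_ac)
    also have "\<dots> = \<gamma> * t * (\<Sum>h=1..n. Z h \<omega>') + (\<Sum>k=1..n. - \<gamma> * (\<Sum>h=k..n. Z h \<omega>') * W k \<omega>)"
      unfolding sum_weighted_arrivals by (simp add: sum_distrib_left sum_negf mult_ac)
    finally show ?thesis
      by (simp only: iexp_sum of_real_add distrib_left exp_add)
  qed
  have "(\<integral>\<omega>. of_bool (epoch n t \<omega>) * iexp (\<gamma> * (\<Sum>k=1..n. Z k \<omega> * (t - arrival W k \<omega>))) \<partial>P) =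
      (\<integral>\<omega>'. (\<integral>\<omega>. of_bool (epoch n t \<omega>) * iexp (\<gamma> * (\<Sum>k=1..n. Z k \<omega>' * (t - arrival W k \<omega>))) \<partial>P) \<partial>P)"
    using integral_arrivals_jumps'[OF b, of n "\<gamma> * t" "- \<gamma>"] unfolding b_def eq .
  also have "\<dots> = (\<integral>\<omega>. iexp (\<gamma> * t * (\<Sum>h=1..n. Z h \<omega>)) *
       (iter_wconv (\<lambda>k x. iexp (- \<gamma> * (\<Sum>h=k..n. Z h \<omega>) * x)) F n (\<lambda>_. 1) t
      - iter_wconv (\<lambda>k x. iexp (- \<gamma> * (\<Sum>h=k..n. Z h \<omega>) * x)) F n (wconv (\<lambda>_. 1) F (\<lambda>_. 1)) t) \<partial>P)"
    unfolding split
    by (subst iter_wconv_epoch[OF _ _ t])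
      (auto simp: mult.left_commute simp del: arrival_Suc simp flip: integral_mult_right_zero)
  finally show ?thesis .
qed

lemma integral_iexp_Z:
  "(\<integral>\<omega>. iexp (\<Sum>k=1..n. Z k \<omega> * c k) \<partial>P) = (\<Prod>k=1..n. char (distr P borel Y) (c k))"
proof -
  have "indep_vars (\<lambda>_. borel) (\<lambda>k \<omega>. iexp (Z k \<omega> * c k)) {1..n}"
    by (rule indep_vars_compose2[OF indep_vars_subset[OF indep_Z], where Y="\<lambda>k x. iexp (x * c k)"]) auto
  moreover have "integrable P (\<lambda>\<omega>. iexp (Z k \<omega> * c k))" if "k \<in> {1..n}" for k
    using that by (intro integrable_const_bound[where B=1])
      (auto intro!: measurable_compose[OF Z_measurable, where g="\<lambda>x. iexp (x * c k)"])
  ultimately have "(\<integral>\<omega>. (\<Prod>k=1..n. iexp (Z k \<omega> * c k)) \<partial>P) = (\<Prod>k=1..n. \<integral>\<omega>. iexp (Z k \<omega> * c k) \<partial>P)"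
    by (intro indep_vars_lebesgue_integral) auto
  also have "\<dots> = (\<Prod>k=1..n. char (distr P borel Y) (c k))"
  proof (intro prod.cong refl)
    fix k assume k: "k \<in> {1..n}"
    have "char (distr P borel Y) (c k) = char (distr P borel (Z k)) (c k)"
      using k by (simp add: Z_law)
    then show "(\<integral>\<omega>. iexp (Z k \<omega> * c k) \<partial>P) = char (distr P borel Y) (c k)"
      using k by (simp add: char_def integral_distr Z_measurable mult.commute)
  qed
  finally show ?thesis
    by (simp only: iexp_sum)
qed

text \<open>For fixed waiting times the jumps integrate to characteristic functions. What remains
  depends on the last waiting time only through the indicator, so that time may be replaced by an
  independent \<open>X\<close>.\<close>

lemma integral_epoch_char:
  assumes t: "0 \<le> t" and ind: "indep_vars (\<lambda>_. borel) (W(0 := X)) UNIV"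
  shows "(\<integral>\<omega>. of_bool (epoch n t \<omega>) * iexp (\<gamma> * (\<Sum>k=1..n. Z k \<omega> * (t - arrival W k \<omega>))) \<partial>P) =
    (\<integral>\<omega>. of_bool (arrival W n \<omega> \<le> t \<and> X \<omega> > t - arrival W n \<omega>) *
       (\<Prod>k=1..n. char (distr P borel Y) (\<gamma> * (t - arrival W k \<omega>))) \<partial>P)"
proof -
  interpret Y: real_distribution "distr P borel Y"
    by (rule real_distribution_distr) measurable
  define b :: "real \<Rightarrow> real \<Rightarrow> complex" where "b x y = of_bool (x \<le> t \<and> t < y)" for x y
  have b: "case_prod b \<in> borel_measurable (borel \<Otimes>\<^sub>M borel)" "\<And>x y. norm (b x y) \<le> 1"
    unfolding b_def of_bool_def split_beta by auto
  have eq: "\<gamma> * (\<Sum>k=1..n. Z k \<omega>' * (t - arrival W k \<omega>)) =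
      (\<Sum>k=1..n. Z k \<omega>' * (\<gamma> * t + (- \<gamma>) * arrival W k \<omega>))" for \<omega> \<omega>'
    by (simp add: sum_distrib_left algebra_simps)
  have eq': "\<gamma> * t + (- \<gamma>) * arrival W k \<omega> = \<gamma> * (t - arrival W k \<omega>)" for k \<omega>
    by (simp add: algebra_simps)
  let ?w = "\<lambda>\<omega>. \<lambda>k\<in>{1..n}. W k \<omega>"
  define A :: "nat \<Rightarrow> (nat \<Rightarrow> real) \<Rightarrow> real" where "A m w = (\<Sum>k=1..m. w k)" for m w
  have A_meas: "A m \<in> borel_measurable (PiM {1..n} (\<lambda>_. borel))" if "m \<le> n" for m
    unfolding A_def[abs_def] using that
    by (intro borel_measurable_sum measurable_component_singleton) simp
  have [measurable]: "A n \<in> borel_measurable (PiM {1..n} (\<lambda>_. borel))"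
    by (rule A_meas) simp
  have A: "A m (?w \<omega>) = arrival W m \<omega>" if "m \<le> n" for m \<omega>
    unfolding A_def arrival_def by (rule sum.cong) (use that in auto)
  define G where "G w = (\<Prod>k=1..n. char (distr P borel Y) (\<gamma> * (t - A k w)))" for w
  have [measurable]: "G \<in> borel_measurable (PiM {1..n} (\<lambda>_. borel))"
    unfolding G_def[abs_def]
    by (intro borel_measurable_prod measurable_compose[OF _ Y.char_measurable]
        borel_measurable_times borel_measurable_diff A_meas) auto
  have G: "G (?w \<omega>) = (\<Prod>k=1..n. char (distr P borel Y) (\<gamma> * (t - arrival W k \<omega>)))" for \<omega>
    unfolding G_def by (rule prod.cong[OF refl]) (simp only: A atLeastAtMost_iff)
  have G_le: "norm (G w) \<le> 1" for w
    unfolding G_def prod_norm[symmetric] by (rule prod_le_1) (use Y.cmod_char_le_1 in auto)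
  define \<phi> where "\<phi> = (\<lambda>(w, x). of_bool (A n w \<le> t \<and> t < A n w + x) * G w)"
  have \<phi> [measurable]: "\<phi> \<in> borel_measurable (PiM {1..n} (\<lambda>_. borel) \<Otimes>\<^sub>M borel)"
    unfolding \<phi>_def split_beta of_bool_def by measurable
  have \<phi>_le: "norm (\<phi> x) \<le> 1" for x
    using G_le by (auto simp: \<phi>_def norm_mult split: prod.split)
  have "(\<integral>\<omega>. of_bool (epoch n t \<omega>) * iexp (\<gamma> * (\<Sum>k=1..n. Z k \<omega> * (t - arrival W k \<omega>))) \<partial>P) =
      (\<integral>\<omega>. (\<integral>\<omega>'. of_bool (epoch n t \<omega>) * iexp (\<Sum>k=1..n. Z k \<omega>' * (\<gamma> * t + (- \<gamma>) * arrival W k \<omega>)) \<partial>P) \<partial>P)"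
    using integral_arrivals_jumps[OF b, of n "\<gamma> * t" "- \<gamma>"] unfolding b_def eq .
  also have "\<dots> = (\<integral>\<omega>. of_bool (epoch n t \<omega>) * (\<Prod>k=1..n. char (distr P borel Y) (\<gamma> * (t - arrival W k \<omega>))) \<partial>P)"
    unfolding eq' integral_mult_right_zero integral_iexp_Z ..
  also have "\<dots> = (\<integral>\<omega>. \<phi> (?w \<omega>, W (Suc n) \<omega>) \<partial>P)"
    unfolding \<phi>_def prod.case G A[OF order_refl] by simp
  also have "\<dots> = (\<integral>\<omega>. (\<integral>\<omega>'. \<phi> (?w \<omega>, X \<omega>') \<partial>P) \<partial>P)"
    by (rule integral_W_Suc[OF \<phi> \<phi>_le])
  \<comment> \<open>The separate sample point of \<open>X\<close> is merged with that of the
    \<open>W k\<close>. This is where \<open>ind\<close> enters: the free index 0 of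
    \<open>W\<close> holds \<open>X\<close>, so the blocks {1..n} and {0} are independent.\<close>
  also have "\<dots> = (\<integral>\<omega>. \<phi> (?w \<omega>, X \<omega>) \<partial>P)"
  proof -
    have w: "(\<lambda>\<omega>. \<lambda>k\<in>{1..n}. (W(0 := X)) k \<omega>) = ?w"
      by (auto simp: fun_eq_iff)
    have "indep_var (PiM {1..n} (\<lambda>_. borel)) (\<lambda>\<omega>. \<lambda>k\<in>{1..n}. (W(0 := X)) k \<omega>)
        (PiM {0} (\<lambda>_. borel)) (\<lambda>\<omega>. \<lambda>k\<in>{0}. (W(0 := X)) k \<omega>)"
      by (rule indep_var_restrict[OF ind]) auto
    then have ind0: "indep_var (PiM {1..n} (\<lambda>_. borel)) ?w
        (PiM {0} (\<lambda>_. borel)) (\<lambda>\<omega>. \<lambda>k\<in>{0}. (W(0 := X)) k \<omega>)"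
      unfolding w .
    have meas0: "(\<lambda>(w, v). \<phi> (w, v 0)) \<in>
        borel_measurable (PiM {1..n} (\<lambda>_. borel) \<Otimes>\<^sub>M PiM {0} (\<lambda>_. borel))"
      by measurable
    show ?thesis
      using integral_indep_var[OF ind0 meas0, of 1] \<phi>_le by (simp add: split_beta)
  qed
  also have "\<dots> = (\<integral>\<omega>. of_bool (arrival W n \<omega> \<le> t \<and> X \<omega> > t - arrival W n \<omega>) *
       (\<Prod>k=1..n. char (distr P borel Y) (\<gamma> * (t - arrival W k \<omega>))) \<partial>P)"
    unfolding \<phi>_def prod.case G A[OF order_refl]
    by (simp add: less_diff_eq diff_less_eq add.commute)
  finally show ?thesis .
qed

section \<open>Laplace transform in time and the series of (ii)\<close>

text \<open>Since \<open>X\<close> is almost surely nonnegative, the density vanishes almost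
  everywhere on the negative axis, and integrating over [0, \<infinity>) only loses nothing.\<close>

lemma laplace_density_eq:
  assumes f_nonneg: "\<And>x. 0 \<le> f x" and f: "distributed P lborel X (\<lambda>x. ennreal (f x))"
  shows "laplace (\<lambda>x. of_real (f x)) s = (\<integral>\<omega>. exp (- s * of_real (X \<omega>)) \<partial>P)"
proof -
  have "(\<lambda>x. ennreal (f x)) \<in> borel_measurable lborel"
    using f by (simp add: distributed_def)
  \<comment> \<open>\<open>distributed\<close> yields measurability of \<open>ennreal (f x)\<close>
    only; converting back recovers f because f \<ge> 0.\<close>
  then have "(\<lambda>x. enn2real (ennreal (f x))) \<in> borel_measurable lborel"
    by measurable
  then have [measurable]: "f \<in> borel_measurable borel"
    using f_nonneg by simp
  have distr: "distr P borel X = density lborel (\<lambda>x. ennreal (f x))"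
    using f by (simp add: distributed_def cong: distr_cong)
  have "AE x in distr P borel X. 0 \<le> x"
    using X_nonneg by (subst AE_distr_iff) auto
  then have nonneg: "AE x in lborel. 0 < f x \<longrightarrow> 0 \<le> x"
    unfolding distr by (subst (asm) AE_density) auto
  have "(\<integral>\<omega>. exp (- s * of_real (X \<omega>)) \<partial>P) = (\<integral>x. exp (- s * of_real x) \<partial>distr P borel X)"
    by (subst integral_distr) auto
  also have "\<dots> = (\<integral>x. f x *\<^sub>R exp (- s * of_real x) \<partial>lborel)"
    unfolding distr by (subst integral_density) (use f_nonneg in auto)
  also have "\<dots> = (\<integral>x. indicator {0..} x *\<^sub>R (exp (- s * of_real x) * of_real (f x)) \<partial>lborel)"
  proof (rule integral_cong_AE)
    show "AE x in lborel. f x *\<^sub>R exp (- s * of_real x) =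
        indicator {0..} x *\<^sub>R (exp (- s * of_real x) * of_real (f x))"
      using nonneg
    proof eventually_elim
      case (elim x)
      then show ?case
        using f_nonneg[of x] by (cases "0 \<le> x") (auto simp: scaleR_conv_of_real)
    qed
  qed measurable
  finally show ?thesis
    by (simp add: laplace_def set_lebesgue_integral_def)
qed

lemma laplace_density_of_real:
  assumes "\<And>x. 0 \<le> f x" "distributed P lborel X (\<lambda>x. ennreal (f x))"
  shows "laplace (\<lambda>x. of_real (f x)) (of_real \<mu>) = of_real (laplace_X \<mu>)"
  unfolding laplace_density_eq[OF assms] laplace_X_def integral_complex_of_real[symmetric]
  by (simp flip: exp_of_real)

text \<open>For fixed jumps, e^(-\<mu> S_n) times the phase is a product of factors exp(-a_k X_k)
  with a_k = \<mu> - i \<gamma> times the k-th tail sum of jumps. The term with S_(n+1) has one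
  further factor, whose expectation produces 1 - \<open>laplace_X \<mu>\<close>.\<close>

lemma integral_arrivals_prod_laplace:
  fixes f :: "real \<Rightarrow> real"
  assumes \<mu>: "0 < \<mu>"
    and f: "\<And>x. 0 \<le> f x" "distributed P lborel X (\<lambda>x. ennreal (f x))"
  shows "(\<integral>\<omega>. of_real (exp (- \<mu> * arrival W n \<omega>) - exp (- \<mu> * arrival W (Suc n) \<omega>)) *
        iexp (\<gamma> * (\<Sum>k=1..n. Z k \<omega> * arrival W k \<omega>)) \<partial>P) =
    of_real (1 - laplace_X \<mu>) *
      (\<integral>\<omega>. (\<Prod>k=1..n. laplace (\<lambda>x. of_real (f x))
        (of_real \<mu> - \<i> * of_real (\<gamma> * (\<Sum>h=k..n. Z h \<omega>)))) \<partial>P)"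
proof -
  \<comment> \<open>the truncation makes \<open>b\<close> bounded everywhere, not only on the almost sure event of nonnegative waiting times\<close>
  define b :: "real \<Rightarrow> real \<Rightarrow> complex" where
    "b x y = (if 0 \<le> x \<and> x \<le> y then of_real (exp (- \<mu> * x) - exp (- \<mu> * y)) else 0)" for x y
  have b_meas: "case_prod b \<in> borel_measurable (borel \<Otimes>\<^sub>M borel)"
    unfolding b_def split_beta by measurable
  have b_le: "norm (b x y) \<le> 1" for x y
  proof (cases "0 \<le> x \<and> x \<le> y")
    case True
    then have "exp (- \<mu> * y) \<le> exp (- \<mu> * x)" "exp (- \<mu> * x) \<le> 1"
      using \<mu> by auto
    moreover have "0 < exp (- \<mu> * y)"
      by simp
    ultimately have "\<bar>exp (- \<mu> * x) - exp (- \<mu> * y)\<bar> \<le> 1"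
      by linarith
    moreover have "b x y = of_real (exp (- \<mu> * x) - exp (- \<mu> * y))"
      using True by (simp add: b_def)
    ultimately show ?thesis
      by (simp only: norm_of_real)
  next
    case False
    then show ?thesis
      by (auto simp: b_def)
  qed
  have b_AE: "AE \<omega> in P. b (arrival W n \<omega>) (arrival W (Suc n) \<omega>) =
      of_real (exp (- \<mu> * arrival W n \<omega>) - exp (- \<mu> * arrival W (Suc n) \<omega>))"
    using W_nonneg
  proof eventually_elim
    case (elim \<omega>)
    then show ?case
      using arrival_mono[of W \<omega> 0 n] by (simp add: b_def)
  qed
  have [measurable]: "(\<lambda>\<omega>. \<Sum>k=1..n. Z k \<omega> * (0 + c * arrival W k \<omega>)) \<in> borel_measurable P" for c
    by (intro borel_measurable_sum borel_measurable_times Z_measurable) auto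
  have [measurable]: "(\<lambda>\<omega>. b (arrival W n \<omega>) (arrival W (Suc n) \<omega>)) \<in> borel_measurable P"
    using measurable_compose[OF measurable_Pair[OF arrival_measurable[of n] arrival_measurable[of "Suc n"]] b_meas]
    by simp
  define a where "a k \<omega>' = of_real \<mu> - \<i> * of_real (\<gamma> * (\<Sum>h=k..n. Z h \<omega>'))" for k \<omega>'
  have inner: "(\<integral>\<omega>. b (arrival W n \<omega>) (arrival W (Suc n) \<omega>) *
        iexp (\<Sum>k=1..n. Z k \<omega>' * (0 + \<gamma> * arrival W k \<omega>)) \<partial>P) =
      of_real (1 - laplace_X \<mu>) * (\<Prod>k=1..n. laplace (\<lambda>x. of_real (f x)) (a k \<omega>'))" for \<omega>'
  proof -
    define H :: "nat \<Rightarrow> 'w \<Rightarrow> complex" where "H m \<omega> = (\<Prod>k=1..m. exp (- a k \<omega>' * of_real (W k \<omega>)))" for m \<omega>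
    \<comment> \<open>The tail sum from \<open>Suc n\<close> to n is empty: the waiting time in
      progress at time t carries no phase.\<close>
    have a_Suc: "a (Suc n) \<omega>' = of_real \<mu>"
      by (simp add: a_def)
    have norm_le: "norm (exp (- a k \<omega>' * of_real x)) \<le> 1" if "0 \<le> x" for k x
      using \<mu> that by (simp add: a_def)
    have int_H: "integrable P (H m)" for m
    proof (rule integrable_const_bound[where B=1])
      show "AE \<omega> in P. norm (H m \<omega>) \<le> 1"
        using W_nonneg
      proof eventually_elim
        case (elim \<omega>)
        then show ?case
          unfolding H_def prod_norm[symmetric] by (intro prod_le_1 conjI norm_ge_zero norm_le) auto
      qed
      show "H m \<in> borel_measurable P"
        unfolding H_def[abs_def]
        by (intro borel_measurable_prod measurable_compose[OF W_measurable]) auto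
    qed
    then have [measurable]: "H m \<in> borel_measurable P" for m
      by (rule borel_measurable_integrable)
    have int_H_eq: "integral\<^sup>L P (H m) = (\<Prod>k=1..m. laplace (\<lambda>x. of_real (f x)) (a k \<omega>'))" for m
      unfolding H_def laplace_density_eq[OF f]
      by (rule integral_prod_W[where B=1]) (use norm_le in auto)
    have "of_real (exp (- \<mu> * arrival W n \<omega>) - exp (- \<mu> * arrival W (Suc n) \<omega>)) *
        iexp (\<Sum>k=1..n. Z k \<omega>' * (0 + \<gamma> * arrival W k \<omega>)) = H n \<omega> - H (Suc n) \<omega>" for \<omega>
    proof -
      have "(\<Sum>k=1..n. Z k \<omega>' * (0 + \<gamma> * arrival W k \<omega>)) = \<gamma> * (\<Sum>k=1..n. Z k \<omega>' * arrival W k \<omega>)"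
        by (simp add: sum_distrib_left mult_ac)
      also have "\<dots> = (\<Sum>k=1..n. \<gamma> * (\<Sum>h=k..n. Z h \<omega>') * W k \<omega>)"
        unfolding sum_weighted_arrivals by (simp add: sum_distrib_left mult_ac)
      finally have "iexp (\<Sum>k=1..n. Z k \<omega>' * (0 + \<gamma> * arrival W k \<omega>)) =
          (\<Prod>k=1..n. iexp (\<gamma> * (\<Sum>h=k..n. Z h \<omega>') * W k \<omega>))"
        by (simp only: iexp_sum)
      moreover have "complex_of_real (exp (- \<mu> * arrival W n \<omega>)) = (\<Prod>k=1..n. of_real (exp (- \<mu> * W k \<omega>)))"
        by (simp add: arrival_def sum_distrib_left exp_sum flip: sum_negf)
      moreover have "of_real (exp (- \<mu> * W k \<omega>)) * iexp (\<gamma> * (\<Sum>h=k..n. Z h \<omega>') * W k \<omega>) =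
          exp (- a k \<omega>' * of_real (W k \<omega>))" for k
        by (simp add: a_def algebra_simps flip: exp_of_real exp_add)
      ultimately have H_n: "of_real (exp (- \<mu> * arrival W n \<omega>)) *
          iexp (\<Sum>k=1..n. Z k \<omega>' * (0 + \<gamma> * arrival W k \<omega>)) = H n \<omega>"
        by (simp only: H_def flip: prod.distrib)
      have H_Suc: "H (Suc n) \<omega> = H n \<omega> * of_real (exp (- \<mu> * W (Suc n) \<omega>))"
        by (simp add: H_def a_Suc flip: exp_of_real)
      have exp_Suc: "exp (- \<mu> * arrival W (Suc n) \<omega>) = exp (- \<mu> * arrival W n \<omega>) * exp (- \<mu> * W (Suc n) \<omega>)"
        by (simp add: algebra_simps flip: exp_add)
      show ?thesis
        unfolding exp_Suc H_Suc H_n[symmetric] of_real_diff of_real_mult by (simp only: algebra_simps)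
    qed
    then have "AE \<omega> in P. b (arrival W n \<omega>) (arrival W (Suc n) \<omega>) *
        iexp (\<Sum>k=1..n. Z k \<omega>' * (0 + \<gamma> * arrival W k \<omega>)) = H n \<omega> - H (Suc n) \<omega>"
      using b_AE by (auto elim!: eventually_mono simp del: arrival_Suc)
    then have "(\<integral>\<omega>. b (arrival W n \<omega>) (arrival W (Suc n) \<omega>) *
        iexp (\<Sum>k=1..n. Z k \<omega>' * (0 + \<gamma> * arrival W k \<omega>)) \<partial>P) = (\<integral>\<omega>. H n \<omega> - H (Suc n) \<omega> \<partial>P)"
      by (rule integral_cong_AE[rotated 2]) measurable
    also have "\<dots> = integral\<^sup>L P (H n) - integral\<^sup>L P (H (Suc n))"
      by (rule Bochner_Integration.integral_diff[OF int_H int_H])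
    also have "\<dots> = of_real (1 - laplace_X \<mu>) * (\<Prod>k=1..n. laplace (\<lambda>x. of_real (f x)) (a k \<omega>'))"
      by (simp add: int_H_eq a_Suc laplace_density_of_real[OF f] algebra_simps)
    finally show ?thesis .
  qed
  have "(\<integral>\<omega>. of_real (exp (- \<mu> * arrival W n \<omega>) - exp (- \<mu> * arrival W (Suc n) \<omega>)) *
        iexp (\<gamma> * (\<Sum>k=1..n. Z k \<omega> * arrival W k \<omega>)) \<partial>P) =
      (\<integral>\<omega>. of_real (exp (- \<mu> * arrival W n \<omega>) - exp (- \<mu> * arrival W (Suc n) \<omega>)) *
        iexp (\<Sum>k=1..n. Z k \<omega> * (0 + \<gamma> * arrival W k \<omega>)) \<partial>P)"
    by (simp add: sum_distrib_left mult_ac del: arrival_Suc)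
  also have "\<dots> = (\<integral>\<omega>. b (arrival W n \<omega>) (arrival W (Suc n) \<omega>) *
        iexp (\<Sum>k=1..n. Z k \<omega> * (0 + \<gamma> * arrival W k \<omega>)) \<partial>P)"
  proof (rule integral_cong_AE)
    show "AE \<omega> in P. of_real (exp (- \<mu> * arrival W n \<omega>) - exp (- \<mu> * arrival W (Suc n) \<omega>)) *
        iexp (\<Sum>k=1..n. Z k \<omega> * (0 + \<gamma> * arrival W k \<omega>)) =
      b (arrival W n \<omega>) (arrival W (Suc n) \<omega>) * iexp (\<Sum>k=1..n. Z k \<omega> * (0 + \<gamma> * arrival W k \<omega>))"
      using b_AE by eventually_elim simp
  qed measurable
  also have "\<dots> = of_real (1 - laplace_X \<mu>) *
      (\<integral>\<omega>. (\<Prod>k=1..n. laplace (\<lambda>x. of_real (f x)) (a k \<omega>)) \<partial>P)"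
    unfolding integral_arrivals_jumps'[OF b_meas b_le] inner integral_mult_right_zero ..
  finally show ?thesis
    unfolding a_def .
qed

lemma epoch_jumps_measurable:
  "(\<lambda>(t, \<omega>). of_bool (epoch n t \<omega>) * iexp (\<gamma> * (\<Sum>k=1..n. Z k \<omega> * arrival W k \<omega>)))
    \<in> borel_measurable (borel \<Otimes>\<^sub>M P)"
proof -
  have [measurable]: "(\<lambda>\<omega>. \<Sum>k=1..n. Z k \<omega> * arrival W k \<omega>) \<in> borel_measurable P"
    by (intro borel_measurable_sum borel_measurable_times Z_measurable) auto
  show ?thesis
    unfolding of_bool_def split_beta by measurable
qed

text \<open>Fubini in time and probability, with e^(-\<mu>t) on [0, \<infinity>) as dominating
  function. The phase is constant in t, so only e^(-\<mu>t) over [S_n, S_(n+1)) is left to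
  integrate.\<close>

lemma laplace_epoch:
  assumes \<mu>: "0 < \<mu>"
  shows "laplace (\<lambda>t. \<integral>\<omega>. of_bool (epoch n t \<omega>) * iexp (\<gamma> * (\<Sum>k=1..n. Z k \<omega> * arrival W k \<omega>)) \<partial>P) (of_real \<mu>) =
    (\<integral>\<omega>. of_real (exp (- \<mu> * arrival W n \<omega>) - exp (- \<mu> * arrival W (Suc n) \<omega>)) *
        iexp (\<gamma> * (\<Sum>k=1..n. Z k \<omega> * arrival W k \<omega>)) \<partial>P) / of_real \<mu>"
proof -
  interpret pair_sigma_finite lborel P ..
  define J where "J \<omega> = iexp (\<gamma> * (\<Sum>k=1..n. Z k \<omega> * arrival W k \<omega>))" for \<omega>
  have J_meas [measurable]: "J \<in> borel_measurable P"
    unfolding J_def[abs_def]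
    using borel_measurable_sum[of "{1..n}" "\<lambda>k \<omega>. Z k \<omega> * arrival W k \<omega>" P] Z_measurable by simp
  define g :: "real \<Rightarrow> real" where "g t = indicator {0..} t * exp (- \<mu> * t)" for t
  have g: "integrable lborel g"
    unfolding g_def[abs_def] by (rule integrable_exp_Ici[OF \<mu>])
  then have [measurable]: "g \<in> borel_measurable borel"
    by simp
  have g_nonneg: "0 \<le> g t" for t
    by (simp add: g_def)
  let ?k = "\<lambda>t \<omega>. of_real (g t) * (of_bool (epoch n t \<omega>) * J \<omega>)"
  have "integrable (lborel \<Otimes>\<^sub>M P) (\<lambda>x. g (fst x))"
    by (rule Fubini_integrable) (use g g_nonneg in \<open>auto simp: prob_space\<close>)
  then have int: "integrable (lborel \<Otimes>\<^sub>M P) (\<lambda>(t, \<omega>). ?k t \<omega>)"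
  proof (rule Bochner_Integration.integrable_bound)
    show "(\<lambda>(t, \<omega>). ?k t \<omega>) \<in> borel_measurable (lborel \<Otimes>\<^sub>M P)"
      unfolding of_bool_def split_beta by measurable
    show "AE x in lborel \<Otimes>\<^sub>M P. norm (case x of (t, \<omega>) \<Rightarrow> ?k t \<omega>) \<le> norm (g (fst x))"
      by (auto simp: norm_mult J_def split_beta intro!: AE_I2)
  qed
  have "laplace (\<lambda>t. \<integral>\<omega>. of_bool (epoch n t \<omega>) * J \<omega> \<partial>P) (of_real \<mu>) =
      (\<integral>t. (\<integral>\<omega>. ?k t \<omega> \<partial>P) \<partial>lborel)"
    unfolding laplace_def set_lebesgue_integral_def
    by (intro Bochner_Integration.integral_cong refl)
      (simp add: g_def indicator_def del: arrival_Suc flip: exp_of_real)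
  also have "\<dots> = (\<integral>\<omega>. (\<integral>t. ?k t \<omega> \<partial>lborel) \<partial>P)"
    by (rule Fubini_integral[OF int, symmetric])
  also have "\<dots> = (\<integral>\<omega>. of_real (exp (- \<mu> * arrival W n \<omega>) - exp (- \<mu> * arrival W (Suc n) \<omega>)) * J \<omega> / of_real \<mu> \<partial>P)"
  proof (rule integral_cong_AE)
    show "AE \<omega> in P. (\<integral>t. ?k t \<omega> \<partial>lborel) =
        of_real (exp (- \<mu> * arrival W n \<omega>) - exp (- \<mu> * arrival W (Suc n) \<omega>)) * J \<omega> / of_real \<mu>"
      using W_nonneg
    proof eventually_elim
      case (elim \<omega>)
      have S: "0 \<le> arrival W n \<omega>" "arrival W n \<omega> \<le> arrival W (Suc n) \<omega>"
        using arrival_mono[of W \<omega> 0 n] arrival_mono[of W \<omega> n "Suc n"] elim by auto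
      have "(\<integral>t. ?k t \<omega> \<partial>lborel) =
          (\<integral>t. of_real (if arrival W n \<omega> \<le> t \<and> t < arrival W (Suc n) \<omega> then exp (- \<mu> * t) else 0) * J \<omega> \<partial>lborel)"
        using S(1) by (intro Bochner_Integration.integral_cong refl) (auto simp: g_def simp del: arrival_Suc)
      then show ?case
        unfolding integral_mult_left_zero integral_complex_of_real integral_exp_interval[OF S(2) \<mu>]
        by (simp del: arrival_Suc)
    qed
    show "(\<lambda>\<omega>. \<integral>t. ?k t \<omega> \<partial>lborel) \<in> borel_measurable P"
      using int by (intro borel_measurable_integrable integrable_snd)
  qed measurable
  finally show ?thesis
    unfolding J_def by simp
qed

text \<open>The expansion over n holds for each t \<ge> 0 and is integrated termwise against
  e^(-\<mu>t). The constant stays inside the series because convergence is established for the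
  integrated terms.\<close>

lemma laplace_epoch_sums:
  fixes f :: "real \<Rightarrow> real"
  assumes \<mu>: "0 < \<mu>"
    and f: "\<And>x. 0 \<le> f x" "distributed P lborel X (\<lambda>x. ennreal (f x))"
  shows "(\<lambda>n. (1 - laplace (\<lambda>x. of_real (f x)) (of_real \<mu>)) / of_real \<mu> *
      (\<integral>\<omega>. (\<Prod>k=1..n. laplace (\<lambda>x. of_real (f x))
        (of_real \<mu> - \<i> * of_real (\<gamma> * (\<Sum>h=k..n. Z h \<omega>)))) \<partial>P))
    sums laplace (\<lambda>t. \<integral>\<omega>. iexp (\<gamma> * (t * CR_process W Z t \<omega> - CR_integral W Z t \<omega>)) \<partial>P) (of_real \<mu>)"
proof -
  define e where "e n t = (\<integral>\<omega>. of_bool (epoch n t \<omega>) * iexp (\<gamma> * (\<Sum>k=1..n. Z k \<omega> * arrival W k \<omega>)) \<partial>P)" for n t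
  define u where "u n t = indicator {0..} t *\<^sub>R (exp (- of_real \<mu> * of_real t) * e n t)" for n t
  have e_sums: "(\<lambda>n. e n t) sums (\<integral>\<omega>. iexp (\<gamma> * (t * CR_process W Z t \<omega> - CR_integral W Z t \<omega>)) \<partial>P)"
    if "0 \<le> t" for t
  proof -
    \<comment> \<open>Subtracting the integral from t M(t) removes t from the phase, which makes the
      Laplace transform computable.\<close>
    have eq: "\<gamma> * (t * (\<Sum>k=1..n. Z k \<omega>) - (\<Sum>k=1..n. Z k \<omega> * (t - arrival W k \<omega>))) =
        \<gamma> * (\<Sum>k=1..n. Z k \<omega> * arrival W k \<omega>)" for n \<omega>
      by (simp add: sum_distrib_left algebra_simps flip: sum_subtractf)
    have "(\<lambda>(x, y). iexp (\<gamma> * (t * x - y))) \<in> borel_measurable (borel \<Otimes>\<^sub>M borel)"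
      unfolding split_beta by measurable
    from sums_epochs[OF that this] show ?thesis
      unfolding eq e_def by simp
  qed
  have e_meas [measurable]: "e n \<in> borel_measurable borel" for n
    unfolding e_def[abs_def]
    using borel_measurable_lebesgue_integral[OF epoch_jumps_measurable[of n \<gamma>]] by simp
  \<comment> \<open>Taking a = \<mu>/2 in the tail bound leaves e^(-\<mu>t/2), still integrable in
    t, times a geometric factor in n; with a = \<mu> the decay in t would be lost.\<close>
  have u_le: "norm (u n t) \<le> laplace_X (\<mu> / 2) ^ n * (indicator {0..} t * exp (- (\<mu> / 2) * t))" for n t
  proof -
    have "norm (e n t) \<le> (\<integral>\<omega>. norm (of_bool (epoch n t \<omega>) * iexp (\<gamma> * (\<Sum>k=1..n. Z k \<omega> * arrival W k \<omega>))) \<partial>P)"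
      unfolding e_def by (rule integral_norm_bound)
    also have "\<dots> \<le> (\<integral>\<omega>. indicator {\<omega>\<in>space P. arrival W n \<omega> \<le> t} \<omega> \<partial>P)"
      by (rule integral_mono'[OF integrable_real_indicator])
        (auto simp: indicator_def norm_mult less_top[symmetric])
    also have "\<dots> \<le> exp (\<mu> / 2 * t) * laplace_X (\<mu> / 2) ^ n"
      using prob_arrival_le[of "\<mu> / 2" n t] \<mu> by simp
    finally have "exp (- \<mu> * t) * norm (e n t) \<le> exp (- \<mu> * t) * (exp (\<mu> / 2 * t) * laplace_X (\<mu> / 2) ^ n)"
      by (intro mult_left_mono) auto
    also have "\<dots> = laplace_X (\<mu> / 2) ^ n * exp (- (\<mu> / 2) * t)"
      by (simp add: field_simps flip: exp_add)
    finally show ?thesis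
      by (auto simp: u_def norm_mult indicator_def)
  qed
  have g: "integrable lborel (\<lambda>t. indicator {0..} t * exp (- (\<mu> / 2) * t))"
    using \<mu> by (intro integrable_exp_Ici) simp
  have u_int: "integrable lborel (u n)" for n
  proof (rule Bochner_Integration.integrable_bound[OF integrable_mult_right[OF g]])
    show "u n \<in> borel_measurable lborel"
      unfolding u_def[abs_def] by measurable
    show "AE t in lborel. norm (u n t) \<le> norm (laplace_X (\<mu> / 2) ^ n * (indicator {0..} t * exp (- (\<mu> / 2) * t)))"
      by (intro AE_I2 order_trans[OF u_le]) simp
  qed
  have geo: "summable (\<lambda>n. laplace_X (\<mu> / 2) ^ n)"
    using \<mu> by (intro summable_laplace_X_power) simp
  have "(\<lambda>n. integral\<^sup>L lborel (u n)) sums (\<integral>t. (\<Sum>n. u n t) \<partial>lborel)"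
  proof (rule sums_integral[OF u_int])
    show "AE t in lborel. summable (\<lambda>n. norm (u n t))"
      by (intro AE_I2 summable_comparison_test'[OF summable_mult2[OF geo]]) (use u_le in auto)
    show "summable (\<lambda>n. \<integral>t. norm (u n t) \<partial>lborel)"
    proof (rule summable_comparison_test'[OF summable_mult2[OF geo]])
      fix n
      have "(\<integral>t. norm (u n t) \<partial>lborel) \<le>
          (\<integral>t. laplace_X (\<mu> / 2) ^ n * (indicator {0..} t * exp (- (\<mu> / 2) * t)) \<partial>lborel)"
        by (intro integral_mono integrable_norm u_int integrable_mult_right g u_le)
      then show "norm (\<integral>t. norm (u n t) \<partial>lborel) \<le>
          laplace_X (\<mu> / 2) ^ n * (\<integral>t. indicator {0..} t * exp (- (\<mu> / 2) * t) \<partial>lborel)"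
        by simp
    qed
  qed
  also have "(\<lambda>n. integral\<^sup>L lborel (u n)) = (\<lambda>n. laplace (e n) (of_real \<mu>))"
    by (simp add: u_def[abs_def] laplace_def set_lebesgue_integral_def)
  also have "\<dots> = (\<lambda>n. (1 - laplace (\<lambda>x. of_real (f x)) (of_real \<mu>)) / of_real \<mu> *
      (\<integral>\<omega>. (\<Prod>k=1..n. laplace (\<lambda>x. of_real (f x))
        (of_real \<mu> - \<i> * of_real (\<gamma> * (\<Sum>h=k..n. Z h \<omega>)))) \<partial>P))"
    unfolding e_def laplace_epoch[OF \<mu>] integral_arrivals_prod_laplace[OF \<mu> f] laplace_density_of_real[OF f] by simp
  also have "(\<integral>t. (\<Sum>n. u n t) \<partial>lborel) =
      laplace (\<lambda>t. \<integral>\<omega>. iexp (\<gamma> * (t * CR_process W Z t \<omega> - CR_integral W Z t \<omega>)) \<partial>P) (of_real \<mu>)"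
    unfolding laplace_def set_lebesgue_integral_def
  proof (intro Bochner_Integration.integral_cong refl)
    fix t
    show "(\<Sum>n. u n t) = indicator {0..} t *\<^sub>R (exp (- of_real \<mu> * of_real t) *
        (\<integral>\<omega>. iexp (\<gamma> * (t * CR_process W Z t \<omega> - CR_integral W Z t \<omega>)) \<partial>P))"
    proof (cases "0 \<le> t")
      case True
      then show ?thesis
        using sums_mult[OF e_sums[OF True]] by (simp add: u_def sums_iff)
    qed (simp add: u_def)
  qed
  finally show ?thesis .
qed

end

text \<open>The phase in (i) is \<gamma>t times the sum of jumps minus \<gamma> times the sum of the
  S_k weighted by the jumps; hence the exponential factor and the weights with -\<gamma>. In (ii)
  the term t M(t) cancels the first part and leaves +\<gamma>, so the Laplace transform is taken at
  \<mu> - i\<gamma>(...). The English display lacks that factor and has the opposite signs. S_n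
  \<le> t is stated explicitly because every X \<ge> 0 satisfies X > t - S_n once S_n > t.\<close>

theorem theorem4p7:
  fixes P :: "'w measure" and X Y :: "'w \<Rightarrow> real" and W Z :: "nat \<Rightarrow> 'w \<Rightarrow> real"
    and \<gamma> :: real
  assumes "compound_renewal P X Y W Z"
  shows "(\<forall>t\<ge>0.
      (\<lambda>n. \<integral>\<omega>. iexp (\<gamma> * t * (\<Sum>h=1..n. Z h \<omega>)) *
           (iter_wconv (\<lambda>k x. iexp (- \<gamma> * (\<Sum>h=k..n. Z h \<omega>) * x)) (distr P borel X) n
              (\<lambda>_. 1) t
          - iter_wconv (\<lambda>k x. iexp (- \<gamma> * (\<Sum>h=k..n. Z h \<omega>) * x)) (distr P borel X) n
              (wconv (\<lambda>_. 1) (distr P borel X) (\<lambda>_. 1)) t) \<partial>P)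
        sums (\<integral>\<omega>. iexp (\<gamma> * CR_integral W Z t \<omega>) \<partial>P)
    \<and> (prob_space.indep_vars P (\<lambda>_. borel) (W(0 := X)) UNIV \<longrightarrow>
      (\<lambda>n. \<integral>\<omega>. of_bool (arrival W n \<omega> \<le> t \<and> X \<omega> > t - arrival W n \<omega>) *
           (\<Prod>k=1..n. char (distr P borel Y) (\<gamma> * (t - arrival W k \<omega>))) \<partial>P)
        sums (\<integral>\<omega>. iexp (\<gamma> * CR_integral W Z t \<omega>) \<partial>P)))
  \<and> (\<forall>f :: real \<Rightarrow> real. \<forall>\<mu>>0.
      (\<forall>x. 0 \<le> f x) \<and> distributed P lborel X (\<lambda>x. ennreal (f x)) \<longrightarrow>
      summable (\<lambda>n. \<integral>\<omega>. (\<Prod>k=1..n. laplace (\<lambda>x. of_real (f x))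
                  (of_real \<mu> - \<i> * of_real (\<gamma> * (\<Sum>h=k..n. Z h \<omega>)))) \<partial>P)
    \<and> laplace (\<lambda>t. \<integral>\<omega>. iexp (\<gamma> * (t * CR_process W Z t \<omega> - CR_integral W Z t \<omega>)) \<partial>P)
              (of_real \<mu>)
      = (1 - laplace (\<lambda>x. of_real (f x)) (of_real \<mu>)) / of_real \<mu> *
        (\<Sum>n. \<integral>\<omega>. (\<Prod>k=1..n. laplace (\<lambda>x. of_real (f x))
                  (of_real \<mu> - \<i> * of_real (\<gamma> * (\<Sum>h=k..n. Z h \<omega>)))) \<partial>P))"
proof -
  interpret compound_renewal P X Y W Z by fact
  have sums: "(\<lambda>n. \<integral>\<omega>. of_bool (epoch n t \<omega>) * iexp (\<gamma> * (\<Sum>k=1..n. Z k \<omega> * (t - arrival W k \<omega>))) \<partial>P)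
      sums (\<integral>\<omega>. iexp (\<gamma> * CR_integral W Z t \<omega>) \<partial>P)" if "0 \<le> t" for t
    using sums_epochs[OF that, of "\<lambda>x y. iexp (\<gamma> * y)"] by (simp add: split_beta del: arrival_Suc)
  have "summable (\<lambda>n. \<integral>\<omega>. (\<Prod>k=1..n. laplace (\<lambda>x. of_real (f x))
          (of_real \<mu> - \<i> * of_real (\<gamma> * (\<Sum>h=k..n. Z h \<omega>)))) \<partial>P) \<and>
      laplace (\<lambda>t. \<integral>\<omega>. iexp (\<gamma> * (t * CR_process W Z t \<omega> - CR_integral W Z t \<omega>)) \<partial>P) (of_real \<mu>)
      = (1 - laplace (\<lambda>x. of_real (f x)) (of_real \<mu>)) / of_real \<mu> *
        (\<Sum>n. \<integral>\<omega>. (\<Prod>k=1..n. laplace (\<lambda>x. of_real (f x))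
                  (of_real \<mu> - \<i> * of_real (\<gamma> * (\<Sum>h=k..n. Z h \<omega>)))) \<partial>P)"
    (is "summable ?T \<and> ?L = ?c * suminf ?T")
    if \<mu>: "0 < \<mu>" and f: "\<And>x. 0 \<le> f x" "distributed P lborel X (\<lambda>x. ennreal (f x))" for f \<mu>
  proof -
    \<comment> \<open>Convergence is known for the series multiplied by \<open>?c\<close>; as
      \<open>?c\<close> is nonzero, the factor can be divided out.\<close>
    have "laplace_X \<mu> \<noteq> 1"
      using laplace_X_less_1[OF \<mu>] by simp
    then have "?c \<noteq> 0"
      unfolding laplace_density_of_real[OF f] using \<mu> by auto
    moreover have L: "(\<lambda>n. ?c * ?T n) sums ?L"
      by (rule laplace_epoch_sums[OF \<mu> f])
    ultimately have "summable ?T"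
      using sums_summable[OF L] by (simp only: summable_cmult_iff) blast
    then show ?thesis
      using sums_unique2[OF L sums_mult[OF summable_sums[OF \<open>summable ?T\<close>]]] by (rule conjI)
  qed
  moreover have "(\<lambda>n. \<integral>\<omega>. iexp (\<gamma> * t * (\<Sum>h=1..n. Z h \<omega>)) *
           (iter_wconv (\<lambda>k x. iexp (- \<gamma> * (\<Sum>h=k..n. Z h \<omega>) * x)) F n (\<lambda>_. 1) t
          - iter_wconv (\<lambda>k x. iexp (- \<gamma> * (\<Sum>h=k..n. Z h \<omega>) * x)) F n
              (wconv (\<lambda>_. 1) F (\<lambda>_. 1)) t) \<partial>P)
        sums (\<integral>\<omega>. iexp (\<gamma> * CR_integral W Z t \<omega>) \<partial>P)" if "0 \<le> t" for t
    using sums[OF that] unfolding integral_epoch_Z[OF that] .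
  moreover have "(\<lambda>n. \<integral>\<omega>. of_bool (arrival W n \<omega> \<le> t \<and> X \<omega> > t - arrival W n \<omega>) *
           (\<Prod>k=1..n. char (distr P borel Y) (\<gamma> * (t - arrival W k \<omega>))) \<partial>P)
        sums (\<integral>\<omega>. iexp (\<gamma> * CR_integral W Z t \<omega>) \<partial>P)"
    if "0 \<le> t" "indep_vars (\<lambda>_. borel) (W(0 := X)) UNIV" for t
    using sums[OF that(1)] unfolding integral_epoch_char[OF that] .
  ultimately show ?thesis
    by blast
qed

end
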